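(* Let $\phi\in BV_r(X,\mathbb{R})$ be a potential for which conditions (i)–(v) listed in the context hold, and suppose that $\phi$ is summable, bounded on balls and rapidly decreasing, i.e. $$\sup_{\underline{a}\in X}\sum_{\underline{b}:\sigma(\underline{b})=\underline{a}}e^{\phi(\underline{b})}<\infty,\qquad \sup_{\underline{c}\in B(\underline{0},R)}|\phi(\underline{c})|<\infty\ \text{ for all }R>0,\qquad \lim_{R\to\infty}\ \sup_{\underline{a}\in\overline{X}^\varrho\setminus B(\underline{0},R)}\mathscr{L}_\phi\mathbf{1}(\underline{a})=0.$$ Then for each $\underline{a}\in\overline{X}^\varrho$ the limit $\lim_{n\to\infty}\frac1n\log\mathscr{L}_\phi^n\mathbf{1}(\underline{a})$ exists and is equal to the pressure $P(\phi)$. This limit is independent of $\underline{a}$.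
   Context: Let $\Sigma^+=\mathbb{Z}^{\mathbb{N}}$ be the set of sequences $\underline{a}=(a_0a_1\cdots)$ of integers, $\sigma(a_0a_1\cdots)=(a_1a_2\cdots)$, $\underline{0}=(00\cdots)$, and $\Sigma_N^+=\{\underline{a}\in\Sigma^+:a_j\in\{-N,\dots,N\}\ \forall j\}$. Let $X\subset\Sigma^+$ satisfy $\sigma(X)=X=\sigma^{-1}(X)$, and let $\varrho$ be a metric on $X$ (not necessarily compatible with the product topology). Standing assumption: for each $N\ge1$, $\Sigma_N^+\subset X$ and $\Sigma_N^+$ is $\varrho$-compact; and every $\varrho$-compact $\Lambda\subset X$ with $\sigma(\Lambda)\subset\Lambda$ is contained in some $\Sigma_N^+$. Notation: for $c^*=c_0\cdots c_{n-1}\in\mathbb{Z}^n$, $c^*\underline{a}=(c_0\cdots c_{n-1}a_0a_1\cdots)$. For $\underline{a}\in X$, $\eta>0$: $B(\underline{a},\eta)$ is the open $\varrho$-ball, $\mathbb{B}_0(\underline{a},\eta)=\{\underline{b}\in X:\varrho(\underline{a},\underline{b})<\eta,\ b_0=a_0\}$, $\mathbb{B}_n(\underline{a},\eta)=\{\underline{b}\in X:\sigma^j\underline{b}\in\mathbb{B}_0(\sigma^j\underline{a},\eta),\ j=0,\dots,n\}$. For $k\in\mathbb{Z}$, $[k]=\{\underline{b}\in X:b_0=k\}$, and for $R>0$, $[k,R]=\{\underline{a}\in[k]:\varrho(\underline{0},\underline{a})>R\}$. Standing assumptions on $\varrho$: there is $\delta_0>0$ such that (Exp) there are $C_{ES}>0$,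 $\lambda_{ES}>1$ with $\varrho(c^*\underline{a},c^*\underline{b})\le C_{ES}\lambda_{ES}^{-n}\varrho(\underline{a},\underline{b})$ for all $n\in\mathbb{N}$, $c^*\in\mathbb{Z}^n$ and $\underline{a},\underline{b}\in X$ with $\varrho(\underline{a},\underline{b})<\delta_0$; (Con) for every $R>0$ there is $n\ge1$ such that $\sigma^nB(\underline{a},\delta_0)\supset B(\underline{0},R)$ for all $\underline{a}\in B(\underline{0},R)$. Potentials: fix $\delta\in(0,\delta_0]$ and $r\in(0,1)$. A continuous $\phi:X\to\mathbb{R}$ is $(\eta,r)$-weakly H\"older if there is $C\ge0$ with $\sup_{\underline{a}\in X}\sup_{\underline{b},\underline{c}\in\mathbb{B}_n(\underline{a},\eta)}|\phi(\underline{b})-\phi(\underline{c})|\le Cr^n$ for all $n\ge0$; $BV_r(X,\mathbb{R})$ is the set of $(\delta,r)$-weakly H\"older functions. Standing assumption (Delta): with $\delta'=\min\{\delta,\delta/C_{ES}\}$, every $(\delta',r)$-weakly H\"older function is $(\delta,r)$-weakly H\"older. Pressure: $S_n\phi=\sum_{k=0}^{n-1}\phi\circ\sigma^k$, $P_{\mathrm{top}}(\phi|_{\Sigma_N^+})=\lim_{n\to\infty}\frac1n\log\sum_{c^*\in\mathbb{Z}^n,\,c^*\underline{a}\in\Sigma_N^+}e^{S_n\phi(c^*\underline{a})}$ (with $\underline{a}\in\Sigma_N^+$), and $P(\phi)=\sup_{N\ge1}P_{\mathrm{top}}(\phi|_{\Sigma_N^+})$. Conditions, where $\overline{X}^\varrho$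 is the completion of $(X,\varrho)$ and $\overline{B(\underline{0},R)}=\{\underline{b}\in\overline{X}^\varrho:\varrho(\underline{0},\underline{b})\le R\}$: (i) $\sigma:X\to X$ extends continuously to $\overline{\sigma}:\overline{X}^\varrho\to\overline{X}^\varrho$; (ii) for every $R>0$, $\overline{B(\underline{0},R)}$ is compact in $\overline{X}^\varrho$; (iii) for every $R>0$ and $\underline{b}\in\overline{X}^\varrho\setminus X$ there is $N\ge1$ such that $\overline{\sigma}^n(\underline{b})\in\overline{X}^\varrho\setminus\overline{B(\underline{0},R)}$ for all $n\ge N$; (iv) $\sum_{k\in\mathbb{Z}}e^{\sup\phi|_{[k]}}<\infty$ and $\lim_{R\to\infty}\sum_{k\in\mathbb{Z}}e^{\sup\phi|_{[k,R]}}=0$; (v) $\phi$ has a continuous extension to $\overline{X}^\varrho$ (still denoted $\phi$). Transfer operator: $\mathscr{L}_\phi g(\underline{a})=\sum_{\underline{b}:\sigma(\underline{b})=\underline{a}}e^{\phi(\underline{b})}g(\underline{b})$ for bounded continuous $g$ (with $\sigma$ read as $\overline{\sigma}$ and $\underline{b}\in\overline{X}^\varrho$ when $\underline{a}\in\overline{X}^\varrho$); $\mathbf{1}$ is the constant function $1$. *)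

theory Defs
  imports "HOL-Analysis.Analysis" "HOL-Library.Omega_Words_Fun"
begin

definition shift :: "(nat \<Rightarrow> int) \<Rightarrow> (nat \<Rightarrow> int)" where
  "shift a = (\<lambda>j. a (Suc j))"

definition zero_seq :: "nat \<Rightarrow> int" where
  "zero_seq = (\<lambda>_. 0)"

definition bounded_seqs :: "nat \<Rightarrow> (nat \<Rightarrow> int) set" where
  "bounded_seqs N = {a. \<forall>j. a j \<in> {- int N..int N}}"

text \<open>A metric space of sequences is a value \<open>m\<close> of type \<open>(nat \<Rightarrow> int) metric\<close>:
  the set \<open>X\<close> is \<open>mspace m\<close> and the metric \<open>\<varrho>\<close> is \<open>mdist m\<close>.\<close>

definition cyl :: "(nat \<Rightarrow> int) metric \<Rightarrow> int \<Rightarrow> (nat \<Rightarrow> int) set" where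
  "cyl m k = {b \<in> mspace m. b 0 = k}"

definition cyl_outside :: "(nat \<Rightarrow> int) metric \<Rightarrow> int \<Rightarrow> real \<Rightarrow> (nat \<Rightarrow> int) set" where
  "cyl_outside m k R = {a \<in> cyl m k. mdist m zero_seq a > R}"

definition symb_ball0 :: "(nat \<Rightarrow> int) metric \<Rightarrow> (nat \<Rightarrow> int) \<Rightarrow> real \<Rightarrow> (nat \<Rightarrow> int) set" where
  "symb_ball0 m a \<eta> = {b \<in> mspace m. mdist m a b < \<eta> \<and> b 0 = a 0}"

definition symb_ball :: "(nat \<Rightarrow> int) metric \<Rightarrow> nat \<Rightarrow> (nat \<Rightarrow> int) \<Rightarrow> real \<Rightarrow> (nat \<Rightarrow> int) set" where
  "symb_ball m n a \<eta> =
    {b \<in> mspace m. \<forall>j\<in>{0..n}. (shift ^^ j) b \<in> symb_ball0 m ((shift ^^ j) a) \<eta>}"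

definition weakly_Hoelder ::
  "(nat \<Rightarrow> int) metric \<Rightarrow> real \<Rightarrow> real \<Rightarrow> ((nat \<Rightarrow> int) \<Rightarrow> real) \<Rightarrow> bool" where
  "weakly_Hoelder m \<eta> r \<phi> \<longleftrightarrow>
    continuous_map (mtopology_of m) euclideanreal \<phi> \<and>
    (\<exists>C\<ge>0. \<forall>n. \<forall>a\<in>mspace m. \<forall>b\<in>symb_ball m n a \<eta>. \<forall>c\<in>symb_ball m n a \<eta>.
       \<bar>\<phi> b - \<phi> c\<bar> \<le> C * r ^ n)"

definition BV :: "(nat \<Rightarrow> int) metric \<Rightarrow> real \<Rightarrow> real \<Rightarrow> ((nat \<Rightarrow> int) \<Rightarrow> real) set" where
  "BV m \<delta> r = {\<phi>. weakly_Hoelder m \<delta> r \<phi>}"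

definition birkhoff_sum :: "((nat \<Rightarrow> int) \<Rightarrow> real) \<Rightarrow> nat \<Rightarrow> (nat \<Rightarrow> int) \<Rightarrow> real" where
  "birkhoff_sum \<phi> n a = (\<Sum>k<n. \<phi> ((shift ^^ k) a))"

text \<open>For \<open>a \<in> bounded_seqs N\<close> the index set of this sum is finite.\<close>

definition partition_sum ::
  "((nat \<Rightarrow> int) \<Rightarrow> real) \<Rightarrow> nat \<Rightarrow> nat \<Rightarrow> (nat \<Rightarrow> int) \<Rightarrow> real" where
  "partition_sum \<phi> N n a =
    (\<Sum>c | length c = n \<and> c \<frown> a \<in> bounded_seqs N. exp (birkhoff_sum \<phi> n (c \<frown> a)))"

text \<open>The limit defining the topological pressure does not depend on the reference point;
  the definition takes the common value over all reference points in \<open>bounded_seqs N\<close>.\<close>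

definition top_pressure :: "((nat \<Rightarrow> int) \<Rightarrow> real) \<Rightarrow> nat \<Rightarrow> real" where
  "top_pressure \<phi> N =
    (THE p. \<forall>a\<in>bounded_seqs N. (\<lambda>n. ln (partition_sum \<phi> N n a) / real n) \<longlonglongrightarrow> p)"

definition pressure :: "((nat \<Rightarrow> int) \<Rightarrow> real) \<Rightarrow> ereal" where
  "pressure \<phi> = (SUP N\<in>{1..}. ereal (top_pressure \<phi> N))"

text \<open>\<open>M\<close> is a completion of \<open>m\<close> with canonical isometric embedding \<open>\<iota>\<close>.\<close>

definition is_completion :: "'a metric \<Rightarrow> 'b metric \<Rightarrow> ('a \<Rightarrow> 'b) \<Rightarrow> bool" where
  "is_completion m M \<iota> \<longleftrightarrow>
    mcomplete_of M \<and>
    \<iota> \<in> mspace m \<rightarrow> mspace M \<and>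
    (\<forall>x\<in>mspace m. \<forall>y\<in>mspace m. mdist M (\<iota> x) (\<iota> y) = mdist m x y) \<and>
    mtopology_of M closure_of (\<iota> ` mspace m) = mspace M"

text \<open>Exponential and logarithm with \<open>exp (- \<infinity>) = 0\<close> and \<open>ln 0 = - \<infinity>\<close>, so that the
  supremum over an empty cylinder contributes \<open>0\<close> to a sum of exponentials.\<close>

definition eexp :: "ereal \<Rightarrow> ennreal" where
  "eexp x = (if x = -\<infinity> then 0 else if x = \<infinity> then top else ennreal (exp (real_of_ereal x)))"

definition eln :: "ennreal \<Rightarrow> ereal" where
  "eln x = (if x = 0 then -\<infinity> else if x = top then \<infinity> else ereal (ln (enn2real x)))"

text \<open>The transfer operator of a map \<open>T\<close> on \<open>Y\<close>, acting on nonnegative functions with values in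
  \<open>[0,\<infinity>]\<close>; the sum over preimages thus always exists, with no convention for divergent sums.\<close>

definition transfer_op ::
  "'b set \<Rightarrow> ('b \<Rightarrow> 'b) \<Rightarrow> ('b \<Rightarrow> real) \<Rightarrow> ('b \<Rightarrow> ennreal) \<Rightarrow> 'b \<Rightarrow> ennreal" where
  "transfer_op Y T \<phi> g a = (\<Sum>\<^sub>\<infinity>b\<in>{b \<in> Y. T b = a}. ennreal (exp (\<phi> b)) * g b)"

end

theory Submission
  imports Defs
begin

text \<open>For a point \<open>a\<close> of the completion and \<open>x \<in> X\<close> close to \<open>a\<close>, the inverse branches \<open>x \<mapsto> c \<frown> x\<close> extend to \<open>a\<close>,
  and since the suprema of \<open>exp \<phi>\<close> over cylinders are summable every preimage of \<open>a\<close> arises in this way.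
  Bounded distortion thus compares the iterates of the transfer operator at \<open>a\<close> with the sums over
  words at \<open>x\<close>, and the covering property (Con) compares the latter with \<open>Z\<^sub>n\<close>, the sum over all
  words \<open>c\<close> of length \<open>n\<close> of the Birkhoff weight of \<open>c \<frown> 0\<close>.
  Words \<open>c\<close> with \<open>c \<frown> 0\<close> in a fixed ball can be prolonged by boundedly many letters to return near \<open>0\<close>,
  hence can be concatenated freely; finitely many of them live in some \<open>bounded_seqs N\<close>, so that
  their total weight is at most \<open>C exp (n P)\<close> with \<open>P\<close> the pressure. As the operator is at most
  \<open>\<epsilon> \<le> exp P / 2\<close> outside a large ball and at most \<open>S\<close> everywhere,
  \<open>Z\<^sub>n\<^sub>+\<^sub>1 \<le> S C exp (n P) + \<epsilon> Z\<^sub>n\<close>, which yields \<open>Z\<^sub>n = O(exp (n P))\<close>. The lower bound holds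
  because near \<open>0\<close> distinct words over finitely many letters have distinct extended branches.\<close>

section \<open>Sums with values in [0,\<infinity>] over arbitrary index sets\<close>

lemma infsum_ennreal_SUP:
  fixes f :: "'a \<Rightarrow> ennreal"
  shows "infsum f A = (SUP F\<in>{F. finite F \<and> F \<subseteq> A}. sum f F)"
  by (rule nonneg_infsum_complete) simp

lemma infsum_ennreal_leI:
  fixes f :: "'a \<Rightarrow> ennreal"
  assumes "\<And>F. finite F \<Longrightarrow> F \<subseteq> A \<Longrightarrow> sum f F \<le> c"
  shows "infsum f A \<le> c"
  unfolding infsum_ennreal_SUP using assms by (auto intro: SUP_least)

lemma sum_le_infsum_ennreal:
  fixes f :: "'a \<Rightarrow> ennreal"
  assumes "finite F" "F \<subseteq> A"
  shows "sum f F \<le> infsum f A"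
  unfolding infsum_ennreal_SUP using assms by (auto intro: SUP_upper)

lemma infsum_ennreal_mono_set:
  fixes f :: "'a \<Rightarrow> ennreal"
  assumes "A \<subseteq> B"
  shows "infsum f A \<le> infsum f B"
  using assms by (auto intro!: infsum_ennreal_leI sum_le_infsum_ennreal)

lemma infsum_ennreal_mono:
  fixes f g :: "'a \<Rightarrow> ennreal"
  assumes "\<And>x. x \<in> A \<Longrightarrow> f x \<le> g x"
  shows "infsum f A \<le> infsum g A"
  by (rule infsum_mono) (auto intro: assms nonneg_summable_on_complete)

lemma infsum_ennreal_cmult:
  fixes f :: "'a \<Rightarrow> ennreal"
  shows "(\<Sum>\<^sub>\<infinity>x\<in>A. c * f x) = c * infsum f A"
proof -
  have ne: "{F. finite F \<and> F \<subseteq> A} \<noteq> {}" by auto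
  have "(\<Sum>\<^sub>\<infinity>x\<in>A. c * f x) = (SUP F\<in>{F. finite F \<and> F \<subseteq> A}. c * sum f F)"
    unfolding infsum_ennreal_SUP sum_distrib_left ..
  also have "\<dots> = c * infsum f A"
    unfolding infsum_ennreal_SUP by (rule SUP_mult_left_ennreal[symmetric])
  finally show ?thesis .
qed

text \<open>For a finite outer index set this is induction with additivity over disjoint fibres. In
  general both inequalities reduce to that case, since a finite subset of \<open>Sigma A B\<close>
  lies over finitely many points of \<open>A\<close>.\<close>

lemma infsum_ennreal_Sigma:
  fixes f :: "'a \<Rightarrow> 'b \<Rightarrow> ennreal"
  shows "(\<Sum>\<^sub>\<infinity>x\<in>A. \<Sum>\<^sub>\<infinity>y\<in>B x. f x y) = (\<Sum>\<^sub>\<infinity>(x, y)\<in>Sigma A B. f x y)"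
proof (rule antisym)
  have fin: "(\<Sum>x\<in>G. infsum (f x) (B x)) = (\<Sum>\<^sub>\<infinity>(x, y)\<in>Sigma G B. f x y)" if "finite G" for G
    using that
  proof induction
    case (insert g G)
    have s: "Sigma (insert g G) B = Pair g ` B g \<union> Sigma G B" by auto
    have "(\<Sum>\<^sub>\<infinity>(x, y)\<in>Sigma (insert g G) B. f x y)
        = (\<Sum>\<^sub>\<infinity>(x, y)\<in>Pair g ` B g. f x y) + (\<Sum>\<^sub>\<infinity>(x, y)\<in>Sigma G B. f x y)"
      unfolding s by (rule infsum_Un_disjoint) (use insert in \<open>auto intro!: nonneg_summable_on_complete\<close>)
    also have "(\<Sum>\<^sub>\<infinity>(x, y)\<in>Pair g ` B g. f x y) = infsum (f g) (B g)"
      by (subst infsum_reindex) (auto simp: inj_on_def o_def)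
    finally show ?case using insert by simp
  qed simp
  show "(\<Sum>\<^sub>\<infinity>x\<in>A. \<Sum>\<^sub>\<infinity>y\<in>B x. f x y) \<le> (\<Sum>\<^sub>\<infinity>(x, y)\<in>Sigma A B. f x y)"
  proof (rule infsum_ennreal_leI)
    fix G assume G: "finite G" "G \<subseteq> A"
    show "(\<Sum>x\<in>G. infsum (f x) (B x)) \<le> (\<Sum>\<^sub>\<infinity>(x, y)\<in>Sigma A B. f x y)"
      unfolding fin[OF G(1)] by (rule infsum_ennreal_mono_set) (use G in auto)
  qed
  show "(\<Sum>\<^sub>\<infinity>(x, y)\<in>Sigma A B. f x y) \<le> (\<Sum>\<^sub>\<infinity>x\<in>A. \<Sum>\<^sub>\<infinity>y\<in>B x. f x y)"
  proof (rule infsum_ennreal_leI)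
    fix F assume F: "finite F" "F \<subseteq> Sigma A B"
    have "sum (\<lambda>(x, y). f x y) F \<le> (\<Sum>\<^sub>\<infinity>(x, y)\<in>Sigma (fst ` F) B. f x y)"
      by (rule sum_le_infsum_ennreal) (use F in force)+
    also have "\<dots> = (\<Sum>x\<in>fst ` F. infsum (f x) (B x))"
      by (rule fin[symmetric]) (use F in auto)
    also have "\<dots> \<le> (\<Sum>\<^sub>\<infinity>x\<in>A. \<Sum>\<^sub>\<infinity>y\<in>B x. f x y)"
      by (rule sum_le_infsum_ennreal) (use F in auto)
    finally show "sum (\<lambda>(x, y). f x y) F \<le> (\<Sum>\<^sub>\<infinity>x\<in>A. \<Sum>\<^sub>\<infinity>y\<in>B x. f x y)" .
  qed
qed

text \<open>One preimage per image point suffices, and the terms left out are nonnegative. This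
  serves later, where different words may give the same extended branch.\<close>

lemma infsum_ennreal_image_le:
  fixes f :: "'b \<Rightarrow> ennreal"
  shows "infsum f (g ` A) \<le> (\<Sum>\<^sub>\<infinity>x\<in>A. f (g x))"
proof -
  obtain A' where A': "A' \<subseteq> A" "inj_on g A'" "g ` A = g ` A'"
    by (metis subset_image_inj order_refl)
  have "infsum f (g ` A) = (\<Sum>\<^sub>\<infinity>x\<in>A'. f (g x))"
    unfolding A'(3) by (subst infsum_reindex) (auto simp: A' o_def)
  also have "\<dots> \<le> (\<Sum>\<^sub>\<infinity>x\<in>A. f (g x))"
    by (rule infsum_ennreal_mono_set) (fact A')
  finally show ?thesis .
qed

text \<open>Fekete's lemma: the quotients converge to their supremum, which is finite by
  \<open>bound\<close>.\<close>

lemma superadditive_limit: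
  fixes b :: "nat \<Rightarrow> real"
  assumes super: "\<And>m n. b m + b n \<le> b (m + n)"
    and bound: "\<And>n. b n \<le> B * real n"
  shows "\<exists>L. (\<lambda>n. b n / real n) \<longlonglongrightarrow> L"
proof -
  define L where "L = (SUP n\<in>{1..}. b n / real n)"
  have bdd: "bdd_above ((\<lambda>n. b n / real n) ` {1..})"
    by (rule bdd_aboveI2[where M = B]) (use bound in \<open>auto simp: field_simps\<close>)
  have up: "b n / real n \<le> L" if "n \<ge> 1" for n
    unfolding L_def by (rule cSUP_upper[OF _ bdd]) (use that in auto)
  have "(\<lambda>n. b n / real n) \<longlonglongrightarrow> L"
  proof (rule LIMSEQ_I)
    fix e :: real assume e: "e > 0"
    obtain k where k: "k \<ge> 1" "b k / real k > L - e / 2"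
      using less_cSUP_iff[OF _ bdd, of "L - e/2"] e unfolding L_def[symmetric] by auto
    \<comment> \<open>\<open>\<beta>\<close> bounds from below the contribution of every remainder
      modulo \<open>k\<close>, so that dividing \<open>n\<close> by \<open>k\<close> with remainder
      costs only a constant independent of \<open>n\<close>.\<close>
    define \<beta> where "\<beta> = Min (b ` {..<k})"
    have mult: "real q * b k + b s \<le> b (q * k + s)" for q s
    proof (induction q)
      case (Suc q)
      have "b k + b (q * k + s) \<le> b (Suc q * k + s)"
        using super[of k "q * k + s"] by (simp add: algebra_simps)
      with Suc show ?case by (simp add: algebra_simps)
    qed simp
    have low: "real n * (b k / real k) - \<bar>b k\<bar> - \<bar>\<beta>\<bar> \<le> b n" for n
    proof -
      have "n mod k < k" using k by simp
      then have "\<beta> \<le> b (n mod k)" unfolding \<beta>_def by (intro Min_le) auto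
      moreover have "real (n div k) * b k + b (n mod k) \<le> b n"
        using mult[of "n div k" "n mod k"] by simp
      moreover have "real n * (b k / real k) - \<bar>b k\<bar> \<le> real (n div k) * b k"
      proof -
        have "real n = real (n div k) * real k + real (n mod k)"
          by (metis div_mult_mod_eq of_nat_add of_nat_mult)
        then have "real n * (b k / real k)
            = real (n div k) * b k + real (n mod k) / real k * b k"
          using k by (simp add: field_simps)
        moreover have "real (n mod k) / real k * b k \<le> \<bar>b k\<bar>"
        proof -
          have "real (n mod k) / real k * b k \<le> real (n mod k) / real k * \<bar>b k\<bar>"
            by (intro mult_left_mono) auto
          also have "\<dots> \<le> 1 * \<bar>b k\<bar>"
            using \<open>n mod k < k\<close> by (intro mult_right_mono) (auto simp: field_simps)
          finally show ?thesis by simp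
        qed
        ultimately show ?thesis by linarith
      qed
      ultimately show ?thesis by linarith
    qed
    obtain n0 :: nat where n0: "real n0 > 2 * (\<bar>b k\<bar> + \<bar>\<beta>\<bar>) / e" using reals_Archimedean2 by blast
    show "\<exists>no. \<forall>n\<ge>no. norm (b n / real n - L) < e"
    proof (intro exI allI impI)
      fix n assume n: "n \<ge> max 1 n0"
      then have "real n > 2 * (\<bar>b k\<bar> + \<bar>\<beta>\<bar>) / e" using n0 by simp
      then have lt: "(\<bar>b k\<bar> + \<bar>\<beta>\<bar>) / real n < e / 2"
        using e n by (simp add: field_simps)
      have ge: "b k / real k - (\<bar>b k\<bar> + \<bar>\<beta>\<bar>) / real n \<le> b n / real n"
      proof -
        have "(real n * (b k / real k) - \<bar>b k\<bar> - \<bar>\<beta>\<bar>) / real n \<le> b n / real n"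
          by (rule divide_right_mono[OF low]) simp
        then show ?thesis using n by (simp add: diff_divide_distrib add_divide_distrib)
      qed
      show "norm (b n / real n - L) < e"
      proof -
        have "b n / real n \<le> L" using up n by simp
        with lt ge k(2) show ?thesis unfolding real_norm_def by linarith
      qed
    qed
  qed
  then show ?thesis ..
qed

section \<open>Iterates of a transfer operator as sums over preimages\<close>

lemma funpow_in:
  assumes "\<And>b. b \<in> Y \<Longrightarrow> T b \<in> Y" "b \<in> Y"
  shows "(T ^^ n) b \<in> Y"
  by (induction n) (auto simp: assms)

text \<open>The outermost application sums over \<open>b\<close> with \<open>T b = a\<close>, the
  induction hypothesis over the \<open>n\<close>-step preimages \<open>b'\<close> of
  \<open>b\<close>. Since \<open>b\<close> is determined by \<open>b'\<close>, the double sum runs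
  over the preimages of order \<open>Suc n\<close>, and \<open>\<phi> b\<close> is the last term of
  the Birkhoff sum of \<open>b'\<close>.\<close>

lemma transfer_op_funpow:
  assumes T: "\<And>b. b \<in> Y \<Longrightarrow> T b \<in> Y" and a: "a \<in> Y"
  shows "(transfer_op Y T \<phi> ^^ n) (\<lambda>_. 1) a =
    (\<Sum>\<^sub>\<infinity>b\<in>{b. b \<in> Y \<and> (T ^^ n) b = a}. ennreal (exp (\<Sum>k<n. \<phi> ((T ^^ k) b))))"
  using a
proof (induction n arbitrary: a)
  case 0
  then have "{b. b \<in> Y \<and> (T ^^ 0) b = a} = {a}" by auto
  then show ?case by simp
next
  case (Suc n)
  define A where "A = {b \<in> Y. T b = a}"
  define B where "B = (\<lambda>b. {b'. b' \<in> Y \<and> (T ^^ n) b' = b})"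
  define S where "S = (\<lambda>n b. \<Sum>k<n. \<phi> ((T ^^ k) b))"
  have "(transfer_op Y T \<phi> ^^ Suc n) (\<lambda>_. 1) a
      = (\<Sum>\<^sub>\<infinity>b\<in>A. ennreal (exp (\<phi> b)) * (\<Sum>\<^sub>\<infinity>b'\<in>B b. ennreal (exp (S n b'))))"
    by (auto simp: transfer_op_def A_def B_def S_def Suc.IH intro!: infsum_cong)
  also have "\<dots> = (\<Sum>\<^sub>\<infinity>b\<in>A. \<Sum>\<^sub>\<infinity>b'\<in>B b. ennreal (exp (S (Suc n) b')))"
    by (auto simp: infsum_ennreal_cmult[symmetric] B_def S_def exp_add ennreal_mult mult_ac
        intro!: infsum_cong)
  also have "\<dots> = (\<Sum>\<^sub>\<infinity>(b, b')\<in>Sigma A B. ennreal (exp (S (Suc n) b')))"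
    by (rule infsum_ennreal_Sigma)
  also have "\<dots> = (\<Sum>\<^sub>\<infinity>b'\<in>{b. b \<in> Y \<and> (T ^^ Suc n) b = a}. ennreal (exp (S (Suc n) b')))"
    by (rule infsum_reindex_bij_witness[of _ "\<lambda>b'. ((T ^^ n) b', b')" snd])
      (auto simp: A_def B_def intro!: funpow_in T)
  finally show ?case by (simp add: S_def)
qed

section \<open>Words, Birkhoff sums and sums over words\<close>

lemma shift_build [simp]: "shift (k ## x) = x"
  by (simp add: shift_def)

lemma shift_funpow: "(shift ^^ n) a = suffix n a"
  by (induction n) (auto simp: shift_def suffix_def fun_eq_iff)

lemma shift_funpow_conc:
  assumes "j \<le> length c"
  shows "(shift ^^ j) (c \<frown> x) = drop j c \<frown> x"
  using assms by (auto simp: shift_funpow fun_eq_iff conc_def add.commute)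

lemma birkhoff_sum_0 [simp]: "birkhoff_sum \<phi> 0 a = 0"
  by (simp add: birkhoff_sum_def)

lemma birkhoff_sum_Suc: "birkhoff_sum \<phi> (Suc n) a = \<phi> a + birkhoff_sum \<phi> n (shift a)"
  by (simp add: birkhoff_sum_def sum.lessThan_Suc_shift funpow_swap1 del: funpow.simps sum.lessThan_Suc)
     (simp add: funpow_swap1)

lemma birkhoff_sum_add:
  "birkhoff_sum \<phi> (k + n) a = birkhoff_sum \<phi> k a + birkhoff_sum \<phi> n ((shift ^^ k) a)"
  by (induction k arbitrary: a) (auto simp: birkhoff_sum_Suc funpow_swap1)

lemma birkhoff_sum_conc_append:
  "birkhoff_sum \<phi> (length c + n) (c \<frown> x) = birkhoff_sum \<phi> (length c) (c \<frown> x) + birkhoff_sum \<phi> n x"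
  by (simp add: birkhoff_sum_add shift_funpow_conc)

definition words :: "int set \<Rightarrow> nat \<Rightarrow> int list set" where
  "words A n = {c. length c = n \<and> set c \<subseteq> A}"

abbreviation letters :: "nat \<Rightarrow> int set" where "letters N \<equiv> {- int N..int N}"

lemma finite_words: "finite A \<Longrightarrow> finite (words A n)"
  using finite_lists_length_eq[of A n] by (simp add: words_def conj_commute)

text \<open>For \<open>A = UNIV\<close> and \<open>x\<close> in the shift space this is the
  \<open>n\<close>-th iterate of the transfer operator of the shift on the function 1. For
  \<open>A = letters N\<close> and \<open>x\<close> in \<open>bounded_seqs N\<close> it is the
  partition sum. Values in [0,\<infinity>] allow both cases to be treated together.\<close>

definition word_sum :: "((nat \<Rightarrow> int) \<Rightarrow> real) \<Rightarrow> int set \<Rightarrow> nat \<Rightarrow> (nat \<Rightarrow> int) \<Rightarrow> ennreal" where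
  "word_sum \<phi> A n x = (\<Sum>\<^sub>\<infinity>c\<in>words A n. ennreal (exp (birkhoff_sum \<phi> n (c \<frown> x))))"

text \<open>The semigroup law of the transfer operator with letters restricted to \<open>A\<close>.
  A word of length \<open>n + k\<close> is cut so that its last \<open>k\<close> letters, the ones
  next to \<open>x\<close>, form the outer sum.\<close>

lemma word_sum_add:
  "word_sum \<phi> A (n + k) x = (\<Sum>\<^sub>\<infinity>c\<in>words A k. ennreal (exp (birkhoff_sum \<phi> k (c \<frown> x))) * word_sum \<phi> A n (c \<frown> x))"
proof -
  have "(\<Sum>\<^sub>\<infinity>c\<in>words A k. ennreal (exp (birkhoff_sum \<phi> k (c \<frown> x))) * word_sum \<phi> A n (c \<frown> x))
     = (\<Sum>\<^sub>\<infinity>c\<in>words A k. \<Sum>\<^sub>\<infinity>c'\<in>words A n.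
          ennreal (exp (birkhoff_sum \<phi> k (c \<frown> x))) * ennreal (exp (birkhoff_sum \<phi> n (c' \<frown> c \<frown> x))))"
    unfolding word_sum_def infsum_ennreal_cmult ..
  also have "\<dots> = (\<Sum>\<^sub>\<infinity>(c, c')\<in>words A k \<times> words A n.
          ennreal (exp (birkhoff_sum \<phi> k (c \<frown> x))) * ennreal (exp (birkhoff_sum \<phi> n (c' \<frown> c \<frown> x))))"
    by (rule infsum_ennreal_Sigma)
  also have "\<dots> = word_sum \<phi> A (n + k) x"
    unfolding word_sum_def
  proof (rule infsum_reindex_bij_witness[of _ "\<lambda>c. (drop n c, take n c)" "\<lambda>(c, c'). c' @ c"])
    fix a assume "a \<in> words A k \<times> words A n"
    then obtain c c' where a: "a = (c, c')" "length c = k" "length c' = n" by (auto simp: words_def)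
    show "ennreal (exp (birkhoff_sum \<phi> (n + k) ((case a of (c, c') \<Rightarrow> c' @ c) \<frown> x))) =
         (case a of (c, c') \<Rightarrow> ennreal (exp (birkhoff_sum \<phi> k (c \<frown> x))) *
            ennreal (exp (birkhoff_sum \<phi> n (c' \<frown> c \<frown> x))))"
      using birkhoff_sum_conc_append[of \<phi> c' k "c \<frown> x"] a
      by (simp add: exp_add ennreal_mult mult.commute)
  qed (auto simp: words_def dest: in_set_takeD in_set_dropD)
  finally show ?thesis ..
qed

lemma word_sum_add_ge:
  assumes "finite F" "F \<subseteq> words A k"
  shows "(\<Sum>c\<in>F. ennreal (exp (birkhoff_sum \<phi> k (c \<frown> x))) * word_sum \<phi> A n (c \<frown> x)) \<le> word_sum \<phi> A (n + k) x"
  unfolding word_sum_add by (rule sum_le_infsum_ennreal) (use assms in auto)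

lemma word_sum_add_ge_single:
  assumes "c \<in> words A k"
  shows "ennreal (exp (birkhoff_sum \<phi> k (c \<frown> x))) * word_sum \<phi> A n (c \<frown> x) \<le> word_sum \<phi> A (n + k) x"
  using word_sum_add_ge[of "{c}" A k \<phi> x n] assms by simp

lemma word_sum_0 [simp]: "word_sum \<phi> A 0 x = 1"
proof -
  have "words A 0 = {[]}" by (auto simp: words_def)
  then show ?thesis by (simp add: word_sum_def)
qed

lemma word_sum_mono: "A \<subseteq> B \<Longrightarrow> word_sum \<phi> A n x \<le> word_sum \<phi> B n x"
  unfolding word_sum_def by (rule infsum_ennreal_mono_set) (auto simp: words_def)

section \<open>The shift space with its completion, extended map and extended potential\<close>

locale completed_shift =
  fixes m :: "(nat \<Rightarrow> int) metric"
    and \<delta>\<^sub>0 C_ES lam_ES \<delta> r :: real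
    and M :: "'b metric" and \<iota> :: "(nat \<Rightarrow> int) \<Rightarrow> 'b"
    and \<sigma>bar :: "'b \<Rightarrow> 'b"
    and \<phi> :: "(nat \<Rightarrow> int) \<Rightarrow> real" and \<phi>bar :: "'b \<Rightarrow> real"
  assumes shift_vimage: "shift -` mspace m = mspace m"
    and bounded_compact: "\<And>N. N \<ge> 1 \<Longrightarrow>
          bounded_seqs N \<subseteq> mspace m \<and> compactin (mtopology_of m) (bounded_seqs N)"
    and \<delta>\<^sub>0_pos: "\<delta>\<^sub>0 > 0" and C_ES_pos: "C_ES > 0" and lam_gt_1: "lam_ES > 1"
    and Exp: "\<And>c a b. \<lbrakk>a \<in> mspace m; b \<in> mspace m; mdist m a b < \<delta>\<^sub>0\<rbrakk>
          \<Longrightarrow> mdist m (c \<frown> a) (c \<frown> b) \<le> C_ES * inverse (lam_ES ^ length c) * mdist m a b"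
    and Con: "\<And>R. R > 0 \<Longrightarrow> \<exists>n\<ge>1. \<forall>a\<in>mball_of m zero_seq R.
          mball_of m zero_seq R \<subseteq> (shift ^^ n) ` mball_of m a \<delta>\<^sub>0"
    and \<delta>_pos: "0 < \<delta>" and \<delta>_le: "\<delta> \<le> \<delta>\<^sub>0" and r_pos: "0 < r" and r_less_1: "r < 1"
    and completion: "is_completion m M \<iota>"
    and phi: "\<phi> \<in> BV m \<delta> r"
    and \<sigma>bar_continuous: "continuous_map (mtopology_of M) (mtopology_of M) \<sigma>bar"
    and \<sigma>bar_\<iota>: "\<And>a. a \<in> mspace m \<Longrightarrow> \<sigma>bar (\<iota> a) = \<iota> (shift a)"
    and compact_balls: "\<And>R. R > 0 \<Longrightarrow> compactin (mtopology_of M) (mcball_of M (\<iota> zero_seq) R)"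
    and sum_cyl: "(\<Sum>\<^sub>\<infinity>k::int. eexp (SUP b\<in>cyl m k. ereal (\<phi> b))) < \<infinity>"
    and \<phi>bar_continuous: "continuous_map (mtopology_of M) euclideanreal \<phi>bar"
    and \<phi>bar_\<iota>: "\<And>a. a \<in> mspace m \<Longrightarrow> \<phi>bar (\<iota> a) = \<phi> a"
    and summable: "(SUP a\<in>mspace m. \<Sum>\<^sub>\<infinity>b\<in>{b \<in> mspace m. shift b = a}. ennreal (exp (\<phi> b))) < \<infinity>"
    and bounded_on_balls: "\<And>R. R > 0 \<Longrightarrow> bdd_above ((\<lambda>c. \<bar>\<phi> c\<bar>) ` mball_of m zero_seq R)"
    and rapidly_decreasing:
          "((\<lambda>R. SUP a\<in>mspace M - mball_of M (\<iota> zero_seq) R.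
               transfer_op (mspace M) \<sigma>bar \<phi>bar (\<lambda>_. 1) a) \<longlongrightarrow> 0) at_top"
begin

sublocale X: Metric_space "mspace m" "mdist m"
  by (rule Metric_space_mspace_mdist)

sublocale Y: Metric_space "mspace M" "mdist M"
  by (rule Metric_space_mspace_mdist)

abbreviation d where "d \<equiv> mdist m"
abbreviation D where "D \<equiv> mdist M"
abbreviation X where "X \<equiv> mspace m"
abbreviation Y where "Y \<equiv> mspace M"

lemma conc_in [simp]: "c \<frown> x \<in> X \<longleftrightarrow> x \<in> X"
proof (induction c)
  case (Cons k c)
  have "(k # c) \<frown> x \<in> X \<longleftrightarrow> shift ((k # c) \<frown> x) \<in> X"
    using shift_vimage by blast
  then show ?case using Cons by simp
qed simp

lemma shift_in [simp]: "shift x \<in> X \<longleftrightarrow> x \<in> X"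
  using shift_vimage by blast

lemma shift_funpow_in [simp]: "(shift ^^ n) x \<in> X \<longleftrightarrow> x \<in> X"
  by (induction n) auto

lemma zero_seq_in_bounded_seqs: "zero_seq \<in> bounded_seqs N"
  by (simp add: zero_seq_def bounded_seqs_def)

lemma bounded_seqs_in: "N \<ge> 1 \<Longrightarrow> x \<in> bounded_seqs N \<Longrightarrow> x \<in> X"
  using bounded_compact by blast

lemma zero_in [simp]: "zero_seq \<in> X"
  using bounded_compact[of 1] zero_seq_in_bounded_seqs by auto

lemma \<iota>_in [simp]: "x \<in> X \<Longrightarrow> \<iota> x \<in> Y"
  using completion by (auto simp: is_completion_def)

lemma D_\<iota> [simp]: "x \<in> X \<Longrightarrow> y \<in> X \<Longrightarrow> D (\<iota> x) (\<iota> y) = d x y"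
  using completion by (auto simp: is_completion_def)

lemma inj_\<iota>: "inj_on \<iota> X"
  by (rule inj_onI) (metis D_\<iota> X.zero Y.zero \<iota>_in)

lemma \<sigma>bar_in [simp]: "b \<in> Y \<Longrightarrow> \<sigma>bar b \<in> Y"
  using \<sigma>bar_continuous by (metis continuous_map_image_subset_topspace image_subset_iff topspace_mtopology_of)

lemma \<sigma>bar_funpow_in [simp]: "b \<in> Y \<Longrightarrow> (\<sigma>bar ^^ n) b \<in> Y"
  by (induction n) auto

lemma \<sigma>bar_funpow_\<iota>: "x \<in> X \<Longrightarrow> (\<sigma>bar ^^ n) (\<iota> x) = \<iota> ((shift ^^ n) x)"
  by (induction n) (auto simp: \<sigma>bar_\<iota>)

subsection \<open>Convergence\<close>

definition conv :: "(nat \<Rightarrow> 'b) \<Rightarrow> 'b \<Rightarrow> bool" where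
  "conv f b \<longleftrightarrow> limitin (mtopology_of M) f b sequentially"

lemma conv_iff: "(\<And>i. f i \<in> Y) \<Longrightarrow> conv f b \<longleftrightarrow> b \<in> Y \<and> (\<lambda>i. D (f i) b) \<longlonglongrightarrow> 0"
  unfolding conv_def mtopology_of_def Y.limitin_metric_dist_null by auto

lemma conv_in: "conv f b \<Longrightarrow> b \<in> Y"
  unfolding conv_def mtopology_of_def Y.limitin_metric_dist_null by auto

lemma conv_unique: "conv f a \<Longrightarrow> conv f b \<Longrightarrow> a = b"
  unfolding conv_def mtopology_of_def by (rule Y.limitin_metric_unique) auto

lemma conv_\<sigma>bar: "conv f b \<Longrightarrow> conv (\<lambda>i. \<sigma>bar (f i)) (\<sigma>bar b)"
  using continuous_map_limit[OF \<sigma>bar_continuous, of f b sequentially] by (simp add: conv_def o_def)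

lemma conv_\<sigma>bar_funpow: "conv f b \<Longrightarrow> conv (\<lambda>i. (\<sigma>bar ^^ n) (f i)) ((\<sigma>bar ^^ n) b)"
  by (induction n) (auto intro: conv_\<sigma>bar)

lemma conv_\<phi>bar: "conv f b \<Longrightarrow> (\<lambda>i. \<phi>bar (f i)) \<longlonglongrightarrow> \<phi>bar b"
  using continuous_map_limit[OF \<phi>bar_continuous, of f b sequentially] by (simp add: conv_def o_def)

lemma conv_subseq: "conv f b \<Longrightarrow> strict_mono s \<Longrightarrow> conv (\<lambda>i. f (s i)) b"
  using limitin_subsequence[of s "mtopology_of M" f b] by (simp add: conv_def o_def)

lemma conv_cong:
  assumes "\<And>i. x i \<in> X" "\<And>i. y i \<in> X" "conv (\<lambda>i. \<iota> (x i)) b" "(\<lambda>i. d (x i) (y i)) \<longlonglongrightarrow> 0"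
  shows "conv (\<lambda>i. \<iota> (y i)) b"
proof -
  have b: "b \<in> Y" "(\<lambda>i. D (\<iota> (x i)) b) \<longlonglongrightarrow> 0" using assms by (auto simp: conv_iff)
  have "(\<lambda>i. D (\<iota> (y i)) b) \<longlonglongrightarrow> 0"
  proof (rule tendsto_sandwich[OF _ _ tendsto_const])
    show "(\<lambda>i. d (x i) (y i) + D (\<iota> (x i)) b) \<longlonglongrightarrow> 0"
      using tendsto_add[OF assms(4) b(2)] by simp
    show "\<forall>\<^sub>F i in sequentially. D (\<iota> (y i)) b \<le> d (x i) (y i) + D (\<iota> (x i)) b"
      using Y.triangle[of "\<iota> (y _)" "\<iota> (x _)" b] assms b by (auto simp: X.commute)
  qed auto
  then show ?thesis using assms b by (simp add: conv_iff)
qed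

lemma dist_tendsto_0:
  assumes "\<And>i. x i \<in> X" "\<And>i. y i \<in> X" "conv (\<lambda>i. \<iota> (x i)) b" "conv (\<lambda>i. \<iota> (y i)) b"
  shows "(\<lambda>i. d (x i) (y i)) \<longlonglongrightarrow> 0"
proof -
  have b: "b \<in> Y" "(\<lambda>i. D (\<iota> (x i)) b) \<longlonglongrightarrow> 0" "(\<lambda>i. D (\<iota> (y i)) b) \<longlonglongrightarrow> 0"
    using assms by (auto simp: conv_iff)
  show ?thesis
  proof (rule tendsto_sandwich[OF _ _ tendsto_const])
    show "(\<lambda>i. D (\<iota> (x i)) b + D (\<iota> (y i)) b) \<longlonglongrightarrow> 0"
      using tendsto_add[OF b(2,3)] by simp
    show "\<forall>\<^sub>F i in sequentially. d (x i) (y i) \<le> D (\<iota> (x i)) b + D (\<iota> (y i)) b"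
    proof (rule always_eventually, rule allI)
      fix i show "d (x i) (y i) \<le> D (\<iota> (x i)) b + D (\<iota> (y i)) b"
        using Y.triangle[of "\<iota> (x i)" b "\<iota> (y i)"] assms b Y.commute[of b "\<iota> (y i)"] by auto
    qed
  qed auto
qed

lemma dense_near:
  assumes "a \<in> Y" "e > 0"
  obtains x where "x \<in> X" "D a (\<iota> x) < e"
proof -
  have "a \<in> Y.mtopology closure_of (\<iota> ` X)"
    using completion assms by (auto simp: is_completion_def mtopology_of_def)
  then have "\<exists>y\<in>\<iota> ` X. y \<in> Y.mball a e"
    using assms unfolding Y.metric_closure_of by blast
  then show ?thesis using that by (auto simp: Y.mball_def)
qed

lemma dense_seq:
  assumes "a \<in> Y"
  obtains x where "\<And>i. x i \<in> X" "conv (\<lambda>i. \<iota> (x i)) a"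
proof -
  have "\<forall>i. \<exists>x. x \<in> X \<and> D a (\<iota> x) < 1 / real (Suc i)"
    using dense_near[OF assms] by (metis of_nat_0_less_iff zero_less_Suc zero_less_divide_1_iff)
  then obtain x where x: "\<And>i. x i \<in> X" "\<And>i. D a (\<iota> (x i)) < 1 / real (Suc i)" by metis
  have "(\<lambda>i. D (\<iota> (x i)) a) \<longlonglongrightarrow> 0"
  proof (rule tendsto_sandwich[OF _ _ tendsto_const lim_1_over_n[THEN LIMSEQ_Suc]])
    show "\<forall>\<^sub>F i in sequentially. D (\<iota> (x i)) a \<le> 1 / real (Suc i)"
      using x(2) by (auto simp: Y.commute less_imp_le)
  qed auto
  then show ?thesis using that[of x] x assms by (simp add: conv_iff)
qed

lemma Exp': "\<lbrakk>a \<in> X; b \<in> X; d a b < \<delta>\<^sub>0\<rbrakk> \<Longrightarrow> d (c \<frown> a) (c \<frown> b) \<le> C_ES * d a b"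
proof -
  assume a: "a \<in> X" "b \<in> X" "d a b < \<delta>\<^sub>0"
  have "inverse (lam_ES ^ length c) \<le> 1"
    using lam_gt_1 by (simp add: inverse_le_1_iff)
  then have "C_ES * inverse (lam_ES ^ length c) * d a b \<le> C_ES * 1 * d a b"
    using C_ES_pos X.nonneg by (intro mult_right_mono mult_left_mono) auto
  then show ?thesis using Exp[OF a, of c] by simp
qed

lemma dist_conc_tendsto_0:
  assumes "\<And>i. x i \<in> X" "\<And>i. y i \<in> X" "(\<lambda>i. d (x i) (y i)) \<longlonglongrightarrow> 0"
  shows "(\<lambda>i. d (c \<frown> x i) (c \<frown> y i)) \<longlonglongrightarrow> 0"
proof (rule tendsto_sandwich[OF _ _ tendsto_const])
  show "(\<lambda>i. C_ES * d (x i) (y i)) \<longlonglongrightarrow> 0"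
    using tendsto_mult_left[OF assms(3), of C_ES] by simp
  have "\<forall>\<^sub>F i in sequentially. d (x i) (y i) < \<delta>\<^sub>0"
    using assms(3) \<delta>\<^sub>0_pos by (rule order_tendstoD)
  then show "\<forall>\<^sub>F i in sequentially. d (c \<frown> x i) (c \<frown> y i) \<le> C_ES * d (x i) (y i)"
    by eventually_elim (use Exp' assms in auto)
qed auto

subsection \<open>Inverse branches on the completion\<close>

text \<open>Prepending \<open>c\<close> is Lipschitz at scales below
  \<open>\<delta>\<^sub>0\<close>, hence preserves Cauchy sequences, and the completion supplies the
  limit. The point \<open>b\<close> is the value at \<open>a\<close> of the inverse branch belonging
  to \<open>c\<close>.\<close>

lemma branch_exists:
  assumes x: "\<And>i. x i \<in> X" and a: "conv (\<lambda>i. \<iota> (x i)) a"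
  shows "\<exists>b. conv (\<lambda>i. \<iota> (c \<frown> x i)) b"
proof -
  have "Y.MCauchy (\<lambda>i. \<iota> (c \<frown> x i))"
    unfolding Y.MCauchy_def
  proof (intro conjI allI impI)
    fix e :: real assume e: "e > 0"
    have "Y.MCauchy (\<lambda>i. \<iota> (x i))"
      using a x unfolding conv_def mtopology_of_def by (intro Y.convergent_imp_MCauchy) auto
    moreover have "min \<delta>\<^sub>0 (e / C_ES) > 0" using e C_ES_pos \<delta>\<^sub>0_pos by simp
    ultimately obtain n0 where n0: "\<And>n n'. n0 \<le> n \<Longrightarrow> n0 \<le> n' \<Longrightarrow> D (\<iota> (x n)) (\<iota> (x n')) < min \<delta>\<^sub>0 (e / C_ES)"
      unfolding Y.MCauchy_def by meson
    show "\<exists>N. \<forall>n n'. N \<le> n \<longrightarrow> N \<le> n' \<longrightarrow> D (\<iota> (c \<frown> x n)) (\<iota> (c \<frown> x n')) < e"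
    proof (intro exI allI impI)
      fix n n' assume "n0 \<le> n" "n0 \<le> n'"
      then have "d (x n) (x n') < \<delta>\<^sub>0" "d (x n) (x n') < e / C_ES" using n0[of n n'] x by auto
      then have "C_ES * d (x n) (x n') < e" using C_ES_pos by (simp add: field_simps)
      then show "D (\<iota> (c \<frown> x n)) (\<iota> (c \<frown> x n')) < e"
        using Exp'[OF x x \<open>d (x n) (x n') < \<delta>\<^sub>0\<close>, of c] x by simp
    qed
  qed (use x in auto)
  moreover have "Y.mcomplete" using completion by (simp add: is_completion_def mcomplete_of_def)
  ultimately show ?thesis unfolding conv_def mtopology_of_def Y.mcomplete_def by blast
qed

lemma exp_phi_le_eexp: "b \<in> cyl m k \<Longrightarrow> ennreal (exp (\<phi> b)) \<le> eexp (SUP b\<in>cyl m k. ereal (\<phi> b))"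
proof -
  assume "b \<in> cyl m k"
  then have le: "ereal (\<phi> b) \<le> (SUP b\<in>cyl m k. ereal (\<phi> b))" by (rule SUP_upper)
  then show ?thesis
    by (cases "SUP b\<in>cyl m k. ereal (\<phi> b)") (auto simp: eexp_def ennreal_leI)
qed

text \<open>Each such letter contributes at least \<open>exp t\<close> to the finite sum in
  \<open>sum_cyl\<close>.\<close>

lemma finite_large_letters:
  "finite {k. \<exists>b\<in>cyl m k. \<phi> b > t}"
proof (rule ccontr)
  assume inf: "infinite {k. \<exists>b\<in>cyl m k. \<phi> b > t}" (is "infinite ?K")
  let ?f = "\<lambda>k. eexp (SUP b\<in>cyl m k. ereal (\<phi> b))"
  have ge: "ennreal (exp t) \<le> ?f k" if "k \<in> ?K" for k
  proof -
    from that obtain b where "b \<in> cyl m k" "\<phi> b > t" by blast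
    then have "ennreal (exp t) \<le> ennreal (exp (\<phi> b))" by (intro ennreal_leI) simp
    also have "\<dots> \<le> ?f k" by (rule exp_phi_le_eexp) fact
    finally show ?thesis .
  qed
  have "infsum ?f ?K = \<infinity>"
    by (rule infsum_superconst_infinite_ennreal[of _ "ennreal (exp t)"]) (use inf ge in auto)
  moreover have "infsum ?f ?K \<le> infsum ?f UNIV" by (rule infsum_ennreal_mono_set) simp
  ultimately show False using sum_cyl by auto
qed

text \<open>Summability of the suprema over cylinders forces a point of the completion to be approached
  within one cylinder.\<close>

lemma preimage_letter:
  assumes x: "\<And>i. x i \<in> X" and a: "conv (\<lambda>i. \<iota> (x i)) (\<sigma>bar b)" and b: "b \<in> Y"
  shows "\<exists>k. conv (\<lambda>i. \<iota> ([k] \<frown> x i)) b"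
proof -
  obtain y where y: "\<And>i. y i \<in> X" "conv (\<lambda>i. \<iota> (y i)) b" using dense_seq[OF b] by blast
  have "(\<lambda>i. \<phi> (y i)) \<longlonglongrightarrow> \<phi>bar b" using conv_\<phi>bar[OF y(2)] y(1) by (simp add: \<phi>bar_\<iota>)
  then have "\<forall>\<^sub>F i in sequentially. \<phi> (y i) > \<phi>bar b - 1" by (rule order_tendstoD) simp
  then obtain n0 where n0: "\<And>i. i \<ge> n0 \<Longrightarrow> \<phi> (y i) > \<phi>bar b - 1"
    unfolding eventually_sequentially by blast
  \<comment> \<open>The potential stays above \<open>\<phi>bar b - 1\<close> along the tail of
    \<open>y\<close>, so only finitely many first letters occur there. By pigeonhole one letter
    \<open>k\<close> occurs along a subsequence.\<close>
  have "(\<lambda>i. y (i + n0) 0) ` UNIV \<subseteq> {k. \<exists>b'\<in>cyl m k. \<phi> b' > \<phi>bar b - 1}"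
    using n0 y(1) by (fastforce simp: cyl_def)
  then have "finite (range (\<lambda>i. y (i + n0) 0))" using finite_large_letters finite_subset by blast
  then obtain k where "infinite {i. y (i + n0) 0 = k}"
    using pigeonhole_infinite[of UNIV "\<lambda>i. y (i + n0) 0"] by auto
  then obtain s :: "nat \<Rightarrow> nat" where "strict_mono s" "\<forall>i. s i \<in> {i. y (i + n0) 0 = k}"
    by (rule infinite_enumerate[THEN exE]) blast
  then have s: "strict_mono s" "\<And>i. y (s i + n0) 0 = k" by auto
  define t where "t = (\<lambda>i. s i + n0)"
  have t: "strict_mono t" using s(1) by (auto simp: t_def strict_mono_def)
  define z where "z = (\<lambda>i. shift (y (t i)))"
  have yz: "y (t i) = [k] \<frown> z i" for i
    using s(2)[of i] by (auto simp: t_def z_def shift_def fun_eq_iff conc_def)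
  have z: "z i \<in> X" for i using y(1) by (simp add: z_def)
  have "conv (\<lambda>i. \<sigma>bar (\<iota> (y (t i)))) (\<sigma>bar b)" by (rule conv_\<sigma>bar[OF conv_subseq[OF y(2) t]])
  then have "conv (\<lambda>i. \<iota> (z i)) (\<sigma>bar b)" using y(1) by (simp add: \<sigma>bar_\<iota> z_def)
  \<comment> \<open>Both \<open>z\<close> and the prescribed sequence \<open>x\<close> converge to
    the image of \<open>b\<close>, so their branches with letter \<open>k\<close> are asymptotic and
    \<open>x\<close> may replace \<open>z\<close>.\<close>
  then have lim: "(\<lambda>i. d ([k] \<frown> z i) ([k] \<frown> x i)) \<longlonglongrightarrow> 0"
    by (rule dist_conc_tendsto_0[OF z x dist_tendsto_0[OF z x _ a]])
  have "conv (\<lambda>i. \<iota> ([k] \<frown> z i)) b"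
    using conv_subseq[OF y(2) t] by (simp only: yz)
  then have "conv (\<lambda>i. \<iota> ([k] \<frown> x i)) b"
    by (rule conv_cong[OF _ _ _ lim, rotated 2]) (simp_all only: conc_in x z)
  then show ?thesis ..
qed

text \<open>One letter is recovered per step, the last one closest to \<open>b\<close>. Uniqueness
  of \<open>c\<close> is not claimed; an upper bound for the operator only needs every preimage to
  be reached by some word.\<close>

lemma preimage_word:
  assumes x: "\<And>i. x i \<in> X" and a: "conv (\<lambda>i. \<iota> (x i)) ((\<sigma>bar ^^ n) b)" and b: "b \<in> Y"
  shows "\<exists>c. length c = n \<and> conv (\<lambda>i. \<iota> (c \<frown> x i)) b"
  using a b
proof (induction n arbitrary: b)
  case (Suc n)
  obtain c where c: "length c = n" "conv (\<lambda>i. \<iota> (c \<frown> x i)) (\<sigma>bar b)"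
    using Suc.IH[of "\<sigma>bar b"] Suc.prems by (auto simp: funpow_swap1)
  obtain k where "conv (\<lambda>i. \<iota> ([k] \<frown> c \<frown> x i)) b"
    using preimage_letter[OF _ c(2) Suc.prems(2)] x by auto
  with c(1) show ?case by (intro exI[of _ "k # c"]) simp
qed simp

subsection \<open>Bounded distortion\<close>

text \<open>Points closer than this radius stay closer than \<delta> after prepending any common
  word, which is the scale of the weak Hoelder condition.\<close>

definition \<delta>\<^sub>1 :: real where "\<delta>\<^sub>1 = min \<delta> (\<delta> / C_ES)"

lemma \<delta>\<^sub>1_pos: "\<delta>\<^sub>1 > 0" and \<delta>\<^sub>1_le: "\<delta>\<^sub>1 \<le> \<delta>\<^sub>0"
  using \<delta>_pos \<delta>_le C_ES_pos by (auto simp: \<delta>\<^sub>1_def)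

lemma \<delta>\<^sub>1_mult: "t < \<delta>\<^sub>1 \<Longrightarrow> C_ES * t < \<delta>"
  using C_ES_pos by (simp add: \<delta>\<^sub>1_def field_simps)

text \<open>While letters of \<open>c\<close> remain, the shifted points are closer than \<delta>
  and share their first letter. The \<open>k\<close>-th shifts therefore lie in a common symbolic
  ball whose order is the number of remaining letters minus one, and the differences sum to a
  geometric series independent of \<open>c\<close>.\<close>

lemma distortion:
  "\<exists>dist_const. \<forall>c. \<forall>x\<in>X. \<forall>y\<in>X. d x y < \<delta>\<^sub>1 \<longrightarrow>
     \<bar>birkhoff_sum \<phi> (length c) (c \<frown> x) - birkhoff_sum \<phi> (length c) (c \<frown> y)\<bar> \<le> dist_const"
proof -
  obtain C where C: "C \<ge> 0" and CH: "\<And>n a b c. \<lbrakk>a \<in> X; b \<in> symb_ball m n a \<delta>; c \<in> symb_ball m n a \<delta>\<rbrakk>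
      \<Longrightarrow> \<bar>\<phi> b - \<phi> c\<bar> \<le> C * r ^ n"
    using phi unfolding BV_def weakly_Hoelder_def by blast
  \<comment> \<open>A symbolic ball of order \<open>n\<close> constrains the letters 0 to
    \<open>n\<close>, and agreement is known for the letters of \<open>c\<close> only; hence the
    order \<open>length c - 1\<close>.\<close>
  have one: "\<bar>\<phi> (c \<frown> x) - \<phi> (c \<frown> y)\<bar> \<le> C * r ^ (length c - 1)"
    if xy: "x \<in> X" "y \<in> X" "d x y < \<delta>\<^sub>1" and c: "c \<noteq> []" for c x y
  proof (rule CH[of "c \<frown> x"])
    have "d (drop j c \<frown> x) (drop j c \<frown> y) < \<delta>" for j
      using Exp'[of x y "drop j c"] \<delta>\<^sub>1_mult[OF xy(3)] \<delta>\<^sub>1_le xy by auto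
    moreover have "(drop j c \<frown> y) 0 = (drop j c \<frown> x) 0" if "j \<le> length c - 1" for j
    proof -
      have "0 < length (drop j c)" using that c by (cases c) auto
      then show ?thesis by simp
    qed
    ultimately show "c \<frown> y \<in> symb_ball m (length c - 1) (c \<frown> x) \<delta>"
      using xy c by (auto simp: symb_ball_def symb_ball0_def shift_funpow_conc)
    show "c \<frown> x \<in> symb_ball m (length c - 1) (c \<frown> x) \<delta>"
      using xy \<delta>_pos by (auto simp: symb_ball_def symb_ball0_def)
  qed (use xy in auto)
  have "\<bar>birkhoff_sum \<phi> (length c) (c \<frown> x) - birkhoff_sum \<phi> (length c) (c \<frown> y)\<bar>
      \<le> C * (\<Sum>i<length c. r ^ i)" if xy: "x \<in> X" "y \<in> X" "d x y < \<delta>\<^sub>1" for c x y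
  proof (induction c)
    case (Cons k c)
    then show ?case using one[OF xy, of "k # c"] by (simp add: birkhoff_sum_Suc distrib_left)
  qed simp
  moreover have "C * (\<Sum>i<n. r ^ i) \<le> C * (1 / (1 - r))" for n
  proof (rule mult_left_mono[OF _ C])
    show "(\<Sum>i<n. r ^ i) \<le> 1 / (1 - r)"
      using r_pos r_less_1 by (simp add: sum_gp_strict divide_right_mono)
  qed
  ultimately show ?thesis by (intro exI[of _ "C * (1 / (1 - r))"]) (meson order_trans)
qed

text \<open>Fixing one witness lets all later estimates share the same distortion constant.\<close>

definition dist_const where "dist_const = (SOME dist_const. \<forall>c. \<forall>x\<in>X. \<forall>y\<in>X. d x y < \<delta>\<^sub>1 \<longrightarrow>
     \<bar>birkhoff_sum \<phi> (length c) (c \<frown> x) - birkhoff_sum \<phi> (length c) (c \<frown> y)\<bar> \<le> dist_const)"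

lemma dist_const: "\<lbrakk>x \<in> X; y \<in> X; d x y < \<delta>\<^sub>1\<rbrakk> \<Longrightarrow>
     \<bar>birkhoff_sum \<phi> (length c) (c \<frown> x) - birkhoff_sum \<phi> (length c) (c \<frown> y)\<bar> \<le> dist_const"
  using someI_ex[OF distortion] unfolding dist_const_def[symmetric] by blast

lemma ennreal_exp_le_mult: "(s::real) \<le> k + t \<Longrightarrow> ennreal (exp s) \<le> ennreal (exp k) * ennreal (exp t)"
  by (simp add: ennreal_mult[symmetric] exp_add[symmetric] ennreal_leI)

lemma word_sum_distortion:
  assumes "x \<in> X" "y \<in> X" "d x y < \<delta>\<^sub>1"
  shows "word_sum \<phi> A n x \<le> ennreal (exp dist_const) * word_sum \<phi> A n y"
  unfolding word_sum_def infsum_ennreal_cmult[symmetric]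
proof (intro infsum_ennreal_mono ennreal_exp_le_mult)
  fix c assume "c \<in> words A n"
  then show "birkhoff_sum \<phi> n (c \<frown> x) \<le> dist_const + birkhoff_sum \<phi> n (c \<frown> y)"
    using dist_const[OF assms, of c] by (auto simp: words_def)
qed

definition birkhoff_sum_bar :: "nat \<Rightarrow> 'b \<Rightarrow> real" where
  "birkhoff_sum_bar n b = (\<Sum>k<n. \<phi>bar ((\<sigma>bar ^^ k) b))"

lemma birkhoff_sum_bar_\<iota>: "x \<in> X \<Longrightarrow> birkhoff_sum_bar n (\<iota> x) = birkhoff_sum \<phi> n x"
  by (simp add: birkhoff_sum_bar_def birkhoff_sum_def \<sigma>bar_funpow_\<iota> \<phi>bar_\<iota>)

lemma birkhoff_sum_bar_add:
  "birkhoff_sum_bar (k + n) b = birkhoff_sum_bar k b + birkhoff_sum_bar n ((\<sigma>bar ^^ k) b)"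
proof (induction n)
  case (Suc n)
  then show ?case by (simp add: birkhoff_sum_bar_def funpow_add[symmetric, THEN fun_cong, unfolded o_def] add.commute)
qed (simp add: birkhoff_sum_bar_def)

text \<open>The sums along \<open>c \<frown> x i\<close> converge to the one at \<open>b\<close> by
  continuity of the extended map and potential. Eventually \<open>x i\<close> is within
  \<open>\<delta>\<^sub>1\<close> of \<open>y\<close>, so the distortion bound survives in the
  limit.\<close>

lemma branch_distortion:
  assumes x: "\<And>i. x i \<in> X" "conv (\<lambda>i. \<iota> (x i)) a" and b: "conv (\<lambda>i. \<iota> (c \<frown> x i)) b"
    and y: "y \<in> X" "D a (\<iota> y) < \<delta>\<^sub>1"
  shows "\<bar>birkhoff_sum_bar (length c) b - birkhoff_sum \<phi> (length c) (c \<frown> y)\<bar> \<le> dist_const"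
proof -
  have a: "a \<in> Y" using conv_in x by blast
  have "(\<lambda>i. birkhoff_sum_bar (length c) (\<iota> (c \<frown> x i))) \<longlonglongrightarrow> birkhoff_sum_bar (length c) b"
    unfolding birkhoff_sum_bar_def by (intro tendsto_sum conv_\<phi>bar conv_\<sigma>bar_funpow b)
  then have "(\<lambda>i. birkhoff_sum \<phi> (length c) (c \<frown> x i)) \<longlonglongrightarrow> birkhoff_sum_bar (length c) b"
    using x by (simp add: birkhoff_sum_bar_\<iota>)
  then have lim: "(\<lambda>i. \<bar>birkhoff_sum \<phi> (length c) (c \<frown> x i) - birkhoff_sum \<phi> (length c) (c \<frown> y)\<bar>)
      \<longlonglongrightarrow> \<bar>birkhoff_sum_bar (length c) b - birkhoff_sum \<phi> (length c) (c \<frown> y)\<bar>"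
    by (intro tendsto_intros)
  have "(\<lambda>i. D (\<iota> (x i)) a) \<longlonglongrightarrow> 0" using x conv_iff[of "\<lambda>i. \<iota> (x i)"] by auto
  then have "\<forall>\<^sub>F i in sequentially. D (\<iota> (x i)) a < \<delta>\<^sub>1 - D a (\<iota> y)"
    by (rule order_tendstoD) (use y in auto)
  then have "\<forall>\<^sub>F i in sequentially.
      \<bar>birkhoff_sum \<phi> (length c) (c \<frown> x i) - birkhoff_sum \<phi> (length c) (c \<frown> y)\<bar> \<le> dist_const"
  proof eventually_elim
    case (elim i)
    have "d (x i) y < \<delta>\<^sub>1" using Y.triangle[of "\<iota> (x i)" a "\<iota> y"] elim x y a by auto
    then show ?case using dist_const x y by blast
  qed
  with lim show ?thesis by (intro tendsto_upperbound) auto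
qed

subsection \<open>The transfer operator on the completion\<close>

definition iter_one :: "nat \<Rightarrow> 'b \<Rightarrow> ennreal" where
  "iter_one n a = (transfer_op Y \<sigma>bar \<phi>bar ^^ n) (\<lambda>_. 1) a"

lemma iter_one_eq: "a \<in> Y \<Longrightarrow>
  iter_one n a = (\<Sum>\<^sub>\<infinity>b\<in>{b. b \<in> Y \<and> (\<sigma>bar ^^ n) b = a}. ennreal (exp (birkhoff_sum_bar n b)))"
  unfolding iter_one_def birkhoff_sum_bar_def by (rule transfer_op_funpow) auto

text \<open>By \<open>preimage_word\<close> the extended branches of all words of length
  \<open>n\<close> exhaust the preimages of \<open>a\<close>. Counting a preimage several times only
  enlarges the sum, and distortion moves the base point to \<open>y\<close>.\<close>

lemma iter_one_le:
  assumes a: "a \<in> Y" and y: "y \<in> X" "D a (\<iota> y) < \<delta>\<^sub>1"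
  shows "iter_one n a \<le> ennreal (exp dist_const) * word_sum \<phi> UNIV n y"
proof -
  obtain x where x: "\<And>i. x i \<in> X" "conv (\<lambda>i. \<iota> (x i)) a" using dense_seq[OF a] by blast
  obtain br where br: "\<And>c. conv (\<lambda>i. \<iota> (c \<frown> x i)) (br c)" using branch_exists[OF x] by metis
  have sub: "{b. b \<in> Y \<and> (\<sigma>bar ^^ n) b = a} \<subseteq> br ` words UNIV n"
  proof clarify
    fix b assume b: "b \<in> Y" and "a = (\<sigma>bar ^^ n) b"
    then obtain c where "length c = n" "conv (\<lambda>i. \<iota> (c \<frown> x i)) b"
      using preimage_word[of x n b] x by auto
    then show "b \<in> br ` words UNIV n" using conv_unique[OF br] by (auto simp: words_def)
  qed
  have "iter_one n a \<le> (\<Sum>\<^sub>\<infinity>b\<in>br ` words UNIV n. ennreal (exp (birkhoff_sum_bar n b)))"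
    unfolding iter_one_eq[OF a] by (rule infsum_ennreal_mono_set[OF sub])
  also have "\<dots> \<le> (\<Sum>\<^sub>\<infinity>c\<in>words UNIV n. ennreal (exp (birkhoff_sum_bar n (br c))))"
    by (rule infsum_ennreal_image_le)
  also have "\<dots> \<le> ennreal (exp dist_const) * word_sum \<phi> UNIV n y"
    unfolding word_sum_def infsum_ennreal_cmult[symmetric]
  proof (intro infsum_ennreal_mono ennreal_exp_le_mult)
    fix c assume "c \<in> words UNIV n"
    then show "birkhoff_sum_bar n (br c) \<le> dist_const + birkhoff_sum \<phi> n (c \<frown> y)"
      using branch_distortion[OF x br y, of c] by (auto simp: words_def)
  qed
  finally show ?thesis .
qed

lemma inj_on_conc: "inj_on (\<lambda>c. c \<frown> x) (words A n)"
proof (rule inj_onI)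
  fix c c' assume "c \<in> words A n" "c' \<in> words A n" "c \<frown> x = c' \<frown> x"
  then show "c = c'" by (metis (mono_tags, lifting) mem_Collect_eq prefix_conc_length words_def)
qed

lemma word_sum_le_infsum_preimages:
  assumes "x \<in> X"
  shows "word_sum \<phi> UNIV n x \<le> (\<Sum>\<^sub>\<infinity>b\<in>{b \<in> X. (shift ^^ n) b = x}. ennreal (exp (birkhoff_sum \<phi> n b)))"
proof -
  have "word_sum \<phi> UNIV n x = (\<Sum>\<^sub>\<infinity>b\<in>(\<lambda>c. c \<frown> x) ` words UNIV n. ennreal (exp (birkhoff_sum \<phi> n b)))"
    unfolding word_sum_def by (subst infsum_reindex[OF inj_on_conc]) (simp add: o_def)
  also have "\<dots> \<le> (\<Sum>\<^sub>\<infinity>b\<in>{b \<in> X. (shift ^^ n) b = x}. ennreal (exp (birkhoff_sum \<phi> n b)))"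
    by (rule infsum_ennreal_mono_set) (use assms in \<open>auto simp: words_def shift_funpow_conc\<close>)
  finally show ?thesis .
qed

text \<open>The preimages of \<open>x\<close> inside \<open>X\<close> embed injectively among those
  of \<open>\<iota> x\<close> in the completion.\<close>

lemma word_sum_le_iter_one:
  assumes "x \<in> X"
  shows "word_sum \<phi> UNIV n x \<le> iter_one n (\<iota> x)"
proof -
  let ?B = "{b \<in> X. (shift ^^ n) b = x}"
  have "word_sum \<phi> UNIV n x \<le> (\<Sum>\<^sub>\<infinity>b\<in>?B. ennreal (exp (birkhoff_sum_bar n (\<iota> b))))"
  proof (rule order_trans[OF word_sum_le_infsum_preimages[OF assms]])
    show "(\<Sum>\<^sub>\<infinity>b\<in>?B. ennreal (exp (birkhoff_sum \<phi> n b)))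
        \<le> (\<Sum>\<^sub>\<infinity>b\<in>?B. ennreal (exp (birkhoff_sum_bar n (\<iota> b))))"
      by (rule infsum_ennreal_mono) (simp add: birkhoff_sum_bar_\<iota>)
  qed
  also have "\<dots> = (\<Sum>\<^sub>\<infinity>b\<in>\<iota> ` ?B. ennreal (exp (birkhoff_sum_bar n b)))"
    by (subst infsum_reindex) (auto simp: o_def intro: inj_on_subset[OF inj_\<iota>])
  also have "\<dots> \<le> iter_one n (\<iota> x)"
    unfolding iter_one_eq[OF \<iota>_in[OF assms]]
    by (rule infsum_ennreal_mono_set) (auto simp: \<sigma>bar_funpow_\<iota>)
  finally show ?thesis .
qed

text \<open>Only the preimages whose orbit passes through \<open>a'\<close> after \<open>n\<close>
  steps are kept.\<close>

lemma iter_one_add_ge: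
  assumes "a' \<in> Y"
  shows "ennreal (exp (birkhoff_sum_bar k a')) * iter_one n a' \<le> iter_one (n + k) ((\<sigma>bar ^^ k) a')"
proof -
  let ?B = "{b. b \<in> Y \<and> (\<sigma>bar ^^ n) b = a'}"
  have "ennreal (exp (birkhoff_sum_bar k a')) * iter_one n a'
      = (\<Sum>\<^sub>\<infinity>b\<in>?B. ennreal (exp (birkhoff_sum_bar (n + k) b)))"
    unfolding iter_one_eq[OF assms] infsum_ennreal_cmult[symmetric]
    by (rule infsum_cong) (auto simp: birkhoff_sum_bar_add exp_add ennreal_mult mult.commute)
  also have "\<dots> \<le> (\<Sum>\<^sub>\<infinity>b\<in>{b. b \<in> Y \<and> (\<sigma>bar ^^ (n + k)) b = (\<sigma>bar ^^ k) a'}.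
      ennreal (exp (birkhoff_sum_bar (n + k) b)))"
    by (rule infsum_ennreal_mono_set) (auto simp: funpow_add add.commute[of n k])
  also have "\<dots> = iter_one (n + k) ((\<sigma>bar ^^ k) a')"
    by (rule iter_one_eq[symmetric]) (use assms in auto)
  finally show ?thesis .
qed

lemma word_sum_1_bound: "\<exists>pre_bound>0. \<forall>x\<in>X. word_sum \<phi> UNIV 1 x \<le> ennreal pre_bound"
proof -
  define T where "T = (SUP a\<in>X. \<Sum>\<^sub>\<infinity>b\<in>{b \<in> X. shift b = a}. ennreal (exp (\<phi> b)))"
  have T: "T < \<infinity>" using summable by (simp add: T_def)
  \<comment> \<open>Adding 1 makes the bound positive, so that its logarithm can be used to bound
    the pressure.\<close>
  have "word_sum \<phi> UNIV 1 x \<le> ennreal (enn2real T + 1)" if "x \<in> X" for x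
  proof -
    have "word_sum \<phi> UNIV 1 x \<le> (\<Sum>\<^sub>\<infinity>b\<in>{b \<in> X. shift b = x}. ennreal (exp (\<phi> b)))"
      using word_sum_le_infsum_preimages[OF that, of 1] by (simp add: birkhoff_sum_Suc)
    also have "\<dots> \<le> T" unfolding T_def by (rule SUP_upper) fact
    also have "\<dots> \<le> ennreal (enn2real T + 1)" using T by (cases T) (auto intro: ennreal_leI)
    finally show ?thesis .
  qed
  then show ?thesis by (intro exI[of _ "enn2real T + 1"]) (auto simp: add_nonneg_pos)
qed

definition pre_bound where "pre_bound = (SOME pre_bound. pre_bound > 0 \<and> (\<forall>x\<in>X. word_sum \<phi> UNIV 1 x \<le> ennreal pre_bound))"

lemma pre_bound_pos: "pre_bound > 0" and word_sum_1_le: "x \<in> X \<Longrightarrow> word_sum \<phi> UNIV 1 x \<le> ennreal pre_bound"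
  using someI_ex[OF word_sum_1_bound] unfolding pre_bound_def[symmetric] by blast+

lemma word_sum_le: "x \<in> X \<Longrightarrow> word_sum \<phi> UNIV n x \<le> ennreal (pre_bound ^ n)"
proof (induction n arbitrary: x)
  case (Suc n)
  have "word_sum \<phi> UNIV (n + 1) x
     \<le> (\<Sum>\<^sub>\<infinity>c\<in>words UNIV 1. ennreal (pre_bound ^ n) * ennreal (exp (birkhoff_sum \<phi> 1 (c \<frown> x))))"
    unfolding word_sum_add
  proof (rule infsum_ennreal_mono)
    fix c show "ennreal (exp (birkhoff_sum \<phi> 1 (c \<frown> x))) * word_sum \<phi> UNIV n (c \<frown> x)
       \<le> ennreal (pre_bound ^ n) * ennreal (exp (birkhoff_sum \<phi> 1 (c \<frown> x)))"
      using Suc by (subst mult.commute) (intro mult_right_mono, auto)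
  qed
  also have "\<dots> = ennreal (pre_bound ^ n) * word_sum \<phi> UNIV 1 x"
    unfolding word_sum_def infsum_ennreal_cmult ..
  also have "\<dots> \<le> ennreal (pre_bound ^ n) * ennreal pre_bound"
    by (intro mult_left_mono word_sum_1_le Suc) auto
  also have "\<dots> = ennreal (pre_bound ^ Suc n)" using pre_bound_pos by (simp add: ennreal_mult[symmetric] mult.commute)
  finally show ?case by simp
qed simp

end

lemma shift_zero_seq [simp]: "shift zero_seq = zero_seq"
  by (simp add: shift_def zero_seq_def)

lemma replicate_conc_zero_seq [simp]: "replicate j 0 \<frown> zero_seq = zero_seq"
  by (auto simp: zero_seq_def conc_def)

lemma bounded_seqs_iff_range: "a \<in> bounded_seqs N \<longleftrightarrow> range a \<subseteq> letters N"
  unfolding bounded_seqs_def image_subset_iff by blast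

lemma conc_in_bounded_seqs:
  assumes "set c \<subseteq> letters N" "x \<in> bounded_seqs N"
  shows "c \<frown> x \<in> bounded_seqs N"
  using assms unfolding bounded_seqs_iff_range range_conc by simp

lemma shift_in_bounded_seqs: "x \<in> bounded_seqs N \<Longrightarrow> shift x \<in> bounded_seqs N"
  by (simp add: bounded_seqs_def shift_def)

context completed_shift
begin

subsection \<open>Returning to the fixed point\<close>

text \<open>The closed ball of the completion is compact, so its image under the continuous extended
  map is bounded; it contains the fixed point \<open>\<iota> zero_seq\<close>.\<close>

lemma ball_shift:
  assumes "R > 0"
  shows "\<exists>R'>0. \<forall>x\<in>X. d zero_seq x \<le> R \<longrightarrow> d zero_seq (shift x) \<le> R'"
proof -
  let ?S = "\<sigma>bar ` mcball_of M (\<iota> zero_seq) R"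
  have "compactin Y.mtopology ?S"
    using image_compactin[OF compact_balls[OF assms] \<sigma>bar_continuous] by (simp add: mtopology_of_def)
  then have "Y.mbounded ?S" by (rule Y.compactin_imp_mbounded)
  then obtain B where B: "B > 0" "\<And>x y. x \<in> ?S \<Longrightarrow> y \<in> ?S \<Longrightarrow> D x y \<le> B"
    unfolding Y.mbounded_alt_pos by blast
  have "d zero_seq (shift x) \<le> B" if x: "x \<in> X" "d zero_seq x \<le> R" for x
  proof -
    have "\<iota> zero_seq \<in> mcball_of M (\<iota> zero_seq) R" "\<iota> x \<in> mcball_of M (\<iota> zero_seq) R"
      using x assms by auto
    then have "D (\<sigma>bar (\<iota> zero_seq)) (\<sigma>bar (\<iota> x)) \<le> B" by (intro B(2)) auto
    then show ?thesis using x by (simp add: \<sigma>bar_\<iota>)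
  qed
  with B(1) show ?thesis by blast
qed

lemma birkhoff_sum_bounded:
  assumes "R > 0"
  shows "\<exists>B. \<forall>x\<in>X. d zero_seq x \<le> R \<longrightarrow> \<bar>birkhoff_sum \<phi> n x\<bar> \<le> B"
  using assms
proof (induction n arbitrary: R)
  case (Suc n)
  obtain R' where R': "R' > 0" "\<And>x. x \<in> X \<Longrightarrow> d zero_seq x \<le> R \<Longrightarrow> d zero_seq (shift x) \<le> R'"
    using ball_shift[OF Suc.prems] by blast
  obtain B where B: "\<And>x. x \<in> X \<Longrightarrow> d zero_seq x \<le> R' \<Longrightarrow> \<bar>birkhoff_sum \<phi> n x\<bar> \<le> B"
    using Suc.IH[OF R'(1)] by blast
  \<comment> \<open>The potential is bounded on open balls, while the points considered may lie at
    distance exactly \<open>R\<close>.\<close>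
  have "R + 1 > 0" using Suc.prems by simp
  then obtain B' where B': "\<And>x. x \<in> mball_of m zero_seq (R + 1) \<Longrightarrow> \<bar>\<phi> x\<bar> \<le> B'"
    using bounded_on_balls[of "R + 1"] unfolding bdd_above_def by blast
  have "\<bar>birkhoff_sum \<phi> (Suc n) x\<bar> \<le> B' + B" if x: "x \<in> X" "d zero_seq x \<le> R" for x
    using B'[of x] B[of "shift x"] R'(2)[of x] x by (auto simp: birkhoff_sum_Suc)
  then show ?case by blast
qed auto

lemma contraction_power:
  assumes "e > 0"
  shows "\<exists>j. C_ES * inverse (lam_ES ^ j) * \<delta>\<^sub>0 < e"
proof -
  have "(\<lambda>j. C_ES * inverse (lam_ES ^ j) * \<delta>\<^sub>0) \<longlonglongrightarrow> C_ES * 0 * \<delta>\<^sub>0"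
    by (intro tendsto_intros LIMSEQ_inverse_realpow_zero lam_gt_1)
  then have "\<forall>\<^sub>F j in sequentially. C_ES * inverse (lam_ES ^ j) * \<delta>\<^sub>0 < e"
    by (rule order_tendstoD) (use assms in simp)
  then show ?thesis by (auto simp: eventually_sequentially)
qed

text \<open>Keep a long prefix of \<open>x\<close> and use (Con) to find, near the remaining tail, a
  point \<open>u\<close> that some iterate of the shift maps to \<open>z\<close>. Prepending the
  prefix contracts the distance between tail and \<open>u\<close> below \<open>e\<close>.\<close>

lemma reach:
  assumes "x \<in> X" "z \<in> X" "e > 0"
  shows "\<exists>w. d (w \<frown> z) x < e"
proof -
  obtain j where j: "C_ES * inverse (lam_ES ^ j) * \<delta>\<^sub>0 < e" using contraction_power assms by blast
  define y where "y = (shift ^^ j) x"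
  define c where "c = prefix j x"
  have xy: "x = c \<frown> y" unfolding c_def y_def shift_funpow by (rule prefix_suffix)
  have y: "y \<in> X" using assms by (simp add: y_def)
  define R where "R = d zero_seq y + d zero_seq z + 1"
  have "R > 0" unfolding R_def using X.nonneg[of zero_seq y] X.nonneg[of zero_seq z] by linarith
  then obtain n where n: "\<forall>a\<in>mball_of m zero_seq R. mball_of m zero_seq R \<subseteq> (shift ^^ n) ` mball_of m a \<delta>\<^sub>0"
    using Con by blast
  have "y \<in> mball_of m zero_seq R" "z \<in> mball_of m zero_seq R"
    using y assms by (auto simp: R_def intro!: add_nonneg_pos)
  with n obtain u where u: "u \<in> X" "d y u < \<delta>\<^sub>0" "(shift ^^ n) u = z" by fastforce
  have uz: "u = prefix n u \<frown> z" using u(3) unfolding shift_funpow by (metis prefix_suffix)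
  have "d (c \<frown> y) (c \<frown> u) \<le> C_ES * inverse (lam_ES ^ j) * d y u"
    using Exp[OF y u(1,2), of c] by (simp add: c_def)
  also have "\<dots> \<le> C_ES * inverse (lam_ES ^ j) * \<delta>\<^sub>0"
    using u C_ES_pos lam_gt_1 by (intro mult_left_mono) auto
  also have "\<dots> < e" by (fact j)
  finally have "d (c \<frown> u) x < e" using X.commute[of x "c \<frown> u"] by (simp add: xy)
  then have "d ((c @ prefix n u) \<frown> z) x < e" using uz by (metis conc_conc)
  then show ?thesis ..
qed

text \<open>The argument of \<open>reach\<close> with target \<open>zero_seq\<close>, whose tails
  all equal itself. Hence the length \<open>k\<close> and the bound \<open>B\<close> depend on
  \<open>R\<close> and \<open>e\<close> but not on the starting point \<open>x\<close>, as free
  concatenation requires.\<close>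

lemma return:
  assumes "R > 0" "e > 0"
  shows "\<exists>k B. \<forall>x\<in>X. d zero_seq x < R \<longrightarrow>
    (\<exists>w. length w = k \<and> d zero_seq (w \<frown> x) < e \<and> \<bar>birkhoff_sum \<phi> k (w \<frown> x)\<bar> \<le> B)"
proof -
  obtain j where j: "C_ES * inverse (lam_ES ^ j) * \<delta>\<^sub>0 < e" using contraction_power assms by blast
  obtain n where n: "\<forall>a\<in>mball_of m zero_seq R. mball_of m zero_seq R \<subseteq> (shift ^^ n) ` mball_of m a \<delta>\<^sub>0"
    using Con assms by blast
  obtain B where B: "\<And>x. x \<in> X \<Longrightarrow> d zero_seq x \<le> e \<Longrightarrow> \<bar>birkhoff_sum \<phi> (j + n) x\<bar> \<le> B"
    using birkhoff_sum_bounded[OF assms(2)] by blast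
  have "\<exists>w. length w = j + n \<and> d zero_seq (w \<frown> x) < e \<and> \<bar>birkhoff_sum \<phi> (j + n) (w \<frown> x)\<bar> \<le> B"
    if x: "x \<in> X" "d zero_seq x < R" for x
  proof -
    have "zero_seq \<in> mball_of m zero_seq R" "x \<in> mball_of m zero_seq R" using x assms by auto
    with n obtain u where u: "u \<in> X" "d zero_seq u < \<delta>\<^sub>0" "(shift ^^ n) u = x" by fastforce
    have ux: "u = prefix n u \<frown> x" using u(3) unfolding shift_funpow by (metis prefix_suffix)
    define w where "w = replicate j 0 @ prefix n u"
    have "d (replicate j 0 \<frown> zero_seq) (replicate j 0 \<frown> u) \<le> C_ES * inverse (lam_ES ^ j) * d zero_seq u"
      using Exp[OF zero_in u(1,2), of "replicate j 0"] by simp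
    also have "\<dots> \<le> C_ES * inverse (lam_ES ^ j) * \<delta>\<^sub>0"
      using u C_ES_pos lam_gt_1 by (intro mult_left_mono) auto
    also have "\<dots> < e" by (fact j)
    finally have "d zero_seq (replicate j 0 \<frown> u) < e" by simp
    then have "d zero_seq (w \<frown> x) < e" unfolding w_def using ux by (metis conc_conc)
    moreover have "length w = j + n" by (simp add: w_def)
    ultimately show ?thesis using B[of "w \<frown> x"] x by (intro exI[of _ w]) auto
  qed
  then show ?thesis by blast
qed

lemma ennreal_le_exp_minus:
  assumes "ennreal (exp s) * a \<le> b"
  shows "a \<le> ennreal (exp (- s)) * b"
proof -
  have "a = ennreal (exp (- s)) * (ennreal (exp s) * a)"
    by (simp add: mult.assoc[symmetric] ennreal_mult[symmetric] exp_add[symmetric])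
  also have "\<dots> \<le> ennreal (exp (- s)) * b" by (rule mult_left_mono[OF assms]) simp
  finally show ?thesis .
qed

text \<open>Distortion moves the base point from \<open>x\<close> to \<open>w \<frown> z\<close>;
  the sum there consists, up to the weight of \<open>w\<close>, of the words over \<open>z\<close>
  that end in \<open>w\<close>.\<close>

lemma word_sum_le_word_sum_reach:
  assumes "x \<in> X" "z \<in> X" "d (w \<frown> z) x < \<delta>\<^sub>1" "set w \<subseteq> A"
  shows "word_sum \<phi> A n x \<le> ennreal (exp (dist_const - birkhoff_sum \<phi> (length w) (w \<frown> z))) * word_sum \<phi> A (n + length w) z"
proof -
  have "word_sum \<phi> A n x \<le> ennreal (exp dist_const) * word_sum \<phi> A n (w \<frown> z)"
    by (rule word_sum_distortion) (use assms in \<open>auto simp: X.commute\<close>)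
  also have "word_sum \<phi> A n (w \<frown> z) \<le> ennreal (exp (- birkhoff_sum \<phi> (length w) (w \<frown> z))) * word_sum \<phi> A (n + length w) z"
    by (intro ennreal_le_exp_minus word_sum_add_ge_single) (use assms in \<open>auto simp: words_def\<close>)
  finally show ?thesis
    by (simp add: mult_left_mono mult.assoc[symmetric] ennreal_mult[symmetric] exp_add[symmetric])
qed

text \<open>Any base point can be exchanged for the fixed point at the price of \<open>k\<close>
  extra letters and a factor, both independent of \<open>n\<close>.\<close>

lemma word_sum_le_word_sum_zero:
  assumes "x \<in> X"
  shows "\<exists>k c. \<forall>n. word_sum \<phi> UNIV n x \<le> ennreal (exp c) * word_sum \<phi> UNIV (n + k) zero_seq"
proof -
  obtain w where w: "d (w \<frown> zero_seq) x < \<delta>\<^sub>1" using reach[OF assms zero_in \<delta>\<^sub>1_pos] by blast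
  show ?thesis using word_sum_le_word_sum_reach[OF assms zero_in w] by blast
qed

subsection \<open>Lower bound for the transfer operator\<close>

lemma continuous_conc: "continuous_map (mtopology_of m) (mtopology_of m) (\<lambda>x. c \<frown> x)"
proof -
  show ?thesis
    unfolding mtopology_of_def X.metric_continuous_map[OF X.Metric_space_axioms]
  proof (intro conjI ballI allI impI)
    fix a and e :: real assume a: "a \<in> X" and e: "e > 0"
    have "d (c \<frown> a) (c \<frown> x) < e" if x: "x \<in> X" "d a x < min \<delta>\<^sub>0 (e / C_ES)" for x
    proof -
      have "C_ES * d a x < e" using x C_ES_pos by (simp add: field_simps)
      then show ?thesis using Exp'[OF a x(1), of c] x by simp
    qed
    then show "\<exists>\<delta>>0. \<forall>x. x \<in> X \<and> d a x < \<delta> \<longrightarrow> d (c \<frown> a) (c \<frown> x) < e"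
      using e C_ES_pos \<delta>\<^sub>0_pos by (intro exI[of _ "min \<delta>\<^sub>0 (e / C_ES)"]) auto
  qed auto
qed

text \<open>The first letter is locally constant on \<open>bounded_seqs N\<close>, since that set is a finite disjoint
  union of the compact sets \<open>[l] \<frown> bounded_seqs N\<close>.\<close>

lemma first_letter_separation:
  assumes N: "N \<ge> 1"
  shows "\<exists>\<gamma>>0. \<forall>x\<in>bounded_seqs N. \<forall>y\<in>bounded_seqs N. d x y < \<gamma> \<longrightarrow> x 0 = y 0"
proof -
  define P where "P = (\<lambda>l. (\<lambda>x. [l] \<frown> x) ` bounded_seqs N)"
  \<comment> \<open>\<open>V k\<close> is open and meets \<open>bounded_seqs N\<close> exactly in
    the sequences starting with \<open>k\<close>. A Lebesgue number of this cover is the required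
    separation.\<close>
  define V where "V = (\<lambda>k. X - (\<Union>l\<in>{- int N..int N} - {k}. P l))"
  have "closedin X.mtopology (P l)" for l
    using image_compactin[OF _ continuous_conc] bounded_compact[OF N] X.Hausdorff_space_mtopology
    unfolding P_def mtopology_of_def by (blast intro: compactin_imp_closedin)
  moreover have "openin X.mtopology X" using openin_topspace[of X.mtopology] by simp
  ultimately have op: "openin X.mtopology (V k)" for k
    unfolding V_def by (intro openin_diff closedin_Union) auto
  have split: "x = [x 0] \<frown> shift x" for x
    by (auto simp: shift_def fun_eq_iff conc_def)
  have mem: "x \<in> V (x 0)" if "x \<in> bounded_seqs N" for x
    using that bounded_seqs_in[OF N] by (auto simp: V_def P_def conc_def)
  have letter: "x 0 = k" if x: "x \<in> bounded_seqs N" "x \<in> V k" for x k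
  proof (rule ccontr)
    assume "x 0 \<noteq> k"
    moreover have "x 0 \<in> letters N" using x(1) by (simp add: bounded_seqs_def)
    moreover have "x \<in> P (x 0)" unfolding P_def using split[of x] shift_in_bounded_seqs[OF x(1)] by blast
    ultimately show False using x(2) by (auto simp: V_def)
  qed
  obtain \<gamma> where \<gamma>: "\<gamma> > 0" "\<And>x. x \<in> bounded_seqs N \<Longrightarrow> \<exists>k. X.mball x \<gamma> \<subseteq> V k"
    using X.lebesgue_number[of "bounded_seqs N" "range V"] bounded_compact[OF N] mem op
    unfolding mtopology_of_def by blast
  have "x 0 = y 0" if xy: "x \<in> bounded_seqs N" "y \<in> bounded_seqs N" "d x y < \<gamma>" for x y
  proof -
    obtain k where k: "X.mball x \<gamma> \<subseteq> V k" using \<gamma>(2)[OF xy(1)] by blast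
    have "x \<in> X.mball x \<gamma>" "y \<in> X.mball x \<gamma>" using xy \<gamma>(1) bounded_seqs_in[OF N] by auto
    then show ?thesis using k letter xy by (metis subsetD)
  qed
  with \<gamma>(1) show ?thesis by blast
qed

text \<open>The Lipschitz estimate for prepending \<open>c\<close> passes to the limit:
  \<open>x i\<close> is eventually within \<open>e\<close> of \<open>y\<close>.\<close>

lemma branch_close:
  assumes x: "\<And>i. x i \<in> X" "conv (\<lambda>i. \<iota> (x i)) a" and b: "conv (\<lambda>i. \<iota> (c \<frown> x i)) b"
    and y: "y \<in> X" "D a (\<iota> y) < e" and e: "e \<le> \<delta>\<^sub>0"
  shows "D (\<iota> (c \<frown> y)) b \<le> C_ES * e"
proof -
  have a: "a \<in> Y" "b \<in> Y" using conv_in x b by blast+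
  have "(\<lambda>i. D (\<iota> (x i)) a) \<longlonglongrightarrow> 0" using x conv_iff[of "\<lambda>i. \<iota> (x i)"] by auto
  then have "\<forall>\<^sub>F i in sequentially. D (\<iota> (x i)) a < e - D a (\<iota> y)"
    by (rule order_tendstoD) (use y in auto)
  then have ev: "\<forall>\<^sub>F i in sequentially. D (\<iota> (c \<frown> y)) b \<le> C_ES * e + D (\<iota> (c \<frown> x i)) b"
  proof eventually_elim
    case (elim i)
    have xy: "d (x i) y < e" using Y.triangle[of "\<iota> (x i)" a "\<iota> y"] elim x y a by auto
    then have "d (c \<frown> x i) (c \<frown> y) \<le> C_ES * d (x i) y" using Exp' x y e by simp
    also have "\<dots> \<le> C_ES * e" using xy C_ES_pos by simp
    finally show ?case
      using Y.triangle[of "\<iota> (c \<frown> y)" "\<iota> (c \<frown> x i)" b] x y a X.commute[of "c \<frown> x i" "c \<frown> y"] by auto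
  qed
  have "(\<lambda>i. D (\<iota> (c \<frown> x i)) b) \<longlonglongrightarrow> 0" using x b conv_iff[of "\<lambda>i. \<iota> (c \<frown> x i)"] by auto
  then have "(\<lambda>i. C_ES * e + D (\<iota> (c \<frown> x i)) b) \<longlonglongrightarrow> C_ES * e + 0" by (intro tendsto_intros)
  then show ?thesis using ev by (intro tendsto_lowerbound[of _ "C_ES * e"]) auto
qed

text \<open>Distinct words over \<open>letters N\<close> give distinct preimages of
  \<open>a\<close>. If the branches of \<open>c\<close> and \<open>c'\<close> coincide, so do those
  of their tails from \<open>j\<close> on; both tails followed by zeros are near that common point,
  hence near each other, and first letter separation yields the same \<open>j\<close>-th
  letter.\<close>

lemma word_sum_le_iter_one_near_zero:
  assumes N: "N \<ge> 1"
  shows "\<exists>e>0. \<forall>a\<in>Y. D a (\<iota> zero_seq) < e \<longrightarrow>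
    (\<forall>n. word_sum \<phi> (letters N) n zero_seq \<le> ennreal (exp dist_const) * iter_one n a)"
proof -
  let ?A = "{- int N..int N}"
  obtain \<gamma> where \<gamma>: "\<gamma> > 0"
    "\<And>x y. x \<in> bounded_seqs N \<Longrightarrow> y \<in> bounded_seqs N \<Longrightarrow> d x y < \<gamma> \<Longrightarrow> x 0 = y 0"
    using first_letter_separation[OF N] by blast
  \<comment> \<open>The factor 3 leaves room for two branch errors, each at most
    \<open>C_ES * e\<close>, to add up to less than \<gamma>.\<close>
  define e where "e = min \<delta>\<^sub>1 (\<gamma> / (3 * C_ES))"
  have e: "e > 0" "e \<le> \<delta>\<^sub>1" "e \<le> \<delta>\<^sub>0" using \<gamma>(1) C_ES_pos \<delta>\<^sub>1_pos \<delta>\<^sub>1_le by (auto simp: e_def)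
  have "C_ES * e \<le> C_ES * (\<gamma> / (3 * C_ES))" using C_ES_pos by (intro mult_left_mono) (auto simp: e_def)
  then have Ce: "2 * (C_ES * e) < \<gamma>" using C_ES_pos \<gamma>(1) by simp
  have "word_sum \<phi> ?A n zero_seq \<le> ennreal (exp dist_const) * iter_one n a" if a: "a \<in> Y" "D a (\<iota> zero_seq) < e" for a n
  proof -
    obtain x where x: "\<And>i. x i \<in> X" "conv (\<lambda>i. \<iota> (x i)) a" using dense_seq[OF a(1)] by blast
    obtain br where br: "\<And>c. conv (\<lambda>i. \<iota> (c \<frown> x i)) (br c)" using branch_exists[OF x] by metis
    have brY: "br c \<in> Y" for c using br conv_in by blast
    have drop: "(\<sigma>bar ^^ j) (br c) = br (drop j c)" if "j \<le> length c" for j c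
    proof (rule conv_unique[OF _ br])
      show "conv (\<lambda>i. \<iota> (drop j c \<frown> x i)) ((\<sigma>bar ^^ j) (br c))"
        using conv_\<sigma>bar_funpow[OF br[of c], of j] x that by (simp add: \<sigma>bar_funpow_\<iota> shift_funpow_conc)
    qed
    have orbit_end: "(\<sigma>bar ^^ length c) (br c) = a" for c
    proof -
      have "br [] = a" using conv_unique[OF br[of "[]"]] x(2) by simp
      then show ?thesis using drop[of "length c" c] by simp
    qed
    have inj: "inj_on br (words ?A n)"
    proof (rule inj_onI)
      fix c c' assume c: "c \<in> words ?A n" and c': "c' \<in> words ?A n" and eq: "br c = br c'"
      show "c = c'"
      proof (rule nth_equalityI)
        show len: "length c = length c'" using c c' by (simp add: words_def)
        fix j assume j: "j < length c"
        have "br (drop j c) = br (drop j c')" using drop[of j c] drop[of j c'] j len eq by simp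
        then have "D (\<iota> (drop j c \<frown> zero_seq)) (br (drop j c)) \<le> C_ES * e"
          "D (\<iota> (drop j c' \<frown> zero_seq)) (br (drop j c)) \<le> C_ES * e"
          using branch_close[OF x br zero_in a(2) e(3)] by metis+
        then have "d (drop j c \<frown> zero_seq) (drop j c' \<frown> zero_seq) < \<gamma>"
          using Y.triangle[of "\<iota> (drop j c \<frown> zero_seq)" "br (drop j c)" "\<iota> (drop j c' \<frown> zero_seq)"]
            Y.commute[of "br (drop j c)" "\<iota> (drop j c' \<frown> zero_seq)"] brY Ce by auto
        moreover have "drop j c \<frown> zero_seq \<in> bounded_seqs N" "drop j c' \<frown> zero_seq \<in> bounded_seqs N"
          using c c' set_drop_subset[of j c] set_drop_subset[of j c'] zero_seq_in_bounded_seqs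
          by (auto simp: words_def intro!: conc_in_bounded_seqs)
        ultimately have "(drop j c \<frown> zero_seq) 0 = (drop j c' \<frown> zero_seq) 0" by (rule \<gamma>(2)[rotated 2])
        then show "c ! j = c' ! j" using j len by simp
      qed
    qed
    have "word_sum \<phi> ?A n zero_seq \<le> (\<Sum>\<^sub>\<infinity>c\<in>words ?A n. ennreal (exp dist_const) * ennreal (exp (birkhoff_sum_bar n (br c))))"
      unfolding word_sum_def
    proof (intro infsum_ennreal_mono ennreal_exp_le_mult)
      fix c assume "c \<in> words ?A n"
      then show "birkhoff_sum \<phi> n (c \<frown> zero_seq) \<le> dist_const + birkhoff_sum_bar n (br c)"
        using branch_distortion[OF x br zero_in, of c] a e by (auto simp: words_def)
    qed
    also have "\<dots> = ennreal (exp dist_const) * (\<Sum>\<^sub>\<infinity>b\<in>br ` words ?A n. ennreal (exp (birkhoff_sum_bar n b)))"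
      unfolding infsum_ennreal_cmult by (subst infsum_reindex[OF inj]) (simp add: o_def)
    also have "\<dots> \<le> ennreal (exp dist_const) * iter_one n a"
      unfolding iter_one_eq[OF a(1)]
      by (intro mult_left_mono infsum_ennreal_mono_set) (auto simp: brY words_def orbit_end)
    finally show ?thesis .
  qed
  with e(1) show ?thesis by blast
qed

text \<open>A word \<open>w\<close> carries \<open>a\<close> back to a preimage \<open>a'\<close>
  near the fixed point, where \<open>word_sum_le_iter_one_near_zero\<close> applies; the orbits
  through \<open>a'\<close> then bound the iterates at \<open>a\<close> from below.\<close>

lemma iter_one_ge:
  assumes N: "N \<ge> 1" and a: "a \<in> Y"
  shows "\<exists>k c. \<forall>n. word_sum \<phi> (letters N) n zero_seq \<le> ennreal (exp c) * iter_one (n + k) a"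
proof -
  obtain e where e: "e > 0" "\<And>a n. a \<in> Y \<Longrightarrow> D a (\<iota> zero_seq) < e \<Longrightarrow>
     word_sum \<phi> (letters N) n zero_seq \<le> ennreal (exp dist_const) * iter_one n a"
    using word_sum_le_iter_one_near_zero[OF N] by blast
  \<comment> \<open>Half of \<open>e\<close> is reserved for replacing \<open>a\<close> by a nearby
    point \<open>y\<close> of \<open>X\<close>, the other half for the return of \<open>y\<close> to
    the fixed point.\<close>
  define e' where "e' = min \<delta>\<^sub>0 (e / (2 * C_ES))"
  have e': "e' > 0" "e' \<le> \<delta>\<^sub>0" using e C_ES_pos \<delta>\<^sub>0_pos by (auto simp: e'_def)
  have "C_ES * e' \<le> C_ES * (e / (2 * C_ES))" using C_ES_pos by (intro mult_left_mono) (auto simp: e'_def)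
  then have Ce: "C_ES * e' \<le> e / 2" using C_ES_pos by simp
  obtain x where x: "\<And>i. x i \<in> X" "conv (\<lambda>i. \<iota> (x i)) a" using dense_seq[OF a] by blast
  obtain y where y: "y \<in> X" "D a (\<iota> y) < e'" using dense_near[OF a e'(1)] by blast
  have "d zero_seq y + 1 > 0" using X.nonneg[of zero_seq y] by linarith
  then obtain w where w: "d zero_seq (w \<frown> y) < e / 2" using return[of "d zero_seq y + 1" "e / 2"] e y
    by fastforce
  obtain a' where a': "conv (\<lambda>i. \<iota> (w \<frown> x i)) a'" using branch_exists[OF x] by blast
  have a'Y: "a' \<in> Y" using a' conv_in by blast
  have "D (\<iota> (w \<frown> y)) a' \<le> e / 2" using branch_close[OF x a' y e'(2)] Ce by simp
  then have "D a' (\<iota> zero_seq) < e"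
    using Y.triangle[of a' "\<iota> (w \<frown> y)" "\<iota> zero_seq"] w y a'Y
      Y.commute[of a' "\<iota> (w \<frown> y)"] X.commute[of "w \<frown> y" zero_seq] by auto
  then have *: "word_sum \<phi> (letters N) n zero_seq \<le> ennreal (exp dist_const) * iter_one n a'" for n
    by (rule e(2)[OF a'Y])
  have "(\<sigma>bar ^^ length w) a' = a"
  proof (rule conv_unique[OF _ x(2)])
    show "conv (\<lambda>i. \<iota> (x i)) ((\<sigma>bar ^^ length w) a')"
      using conv_\<sigma>bar_funpow[OF a', of "length w"] x by (simp add: \<sigma>bar_funpow_\<iota> shift_funpow_conc)
  qed
  then have **: "iter_one n a' \<le> ennreal (exp (- birkhoff_sum_bar (length w) a')) * iter_one (n + length w) a" for n
    using ennreal_le_exp_minus[OF iter_one_add_ge[OF a'Y, of "length w" n]] by simp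
  have "word_sum \<phi> (letters N) n zero_seq
      \<le> ennreal (exp (dist_const - birkhoff_sum_bar (length w) a')) * iter_one (n + length w) a" for n
  proof -
    have "word_sum \<phi> (letters N) n zero_seq
      \<le> ennreal (exp dist_const) * (ennreal (exp (- birkhoff_sum_bar (length w) a')) * iter_one (n + length w) a)"
      by (rule order_trans[OF * mult_left_mono[OF **]]) simp
    then show ?thesis
      by (simp add: mult.assoc[symmetric] ennreal_mult[symmetric] exp_add[symmetric])
  qed
  then show ?thesis by blast
qed

end

lemma finite_int_bounded:
  assumes "finite (L :: int set)"
  shows "\<exists>N\<ge>1. L \<subseteq> letters N"
proof -
  obtain N where N: "\<And>l. l \<in> L \<Longrightarrow> nat \<bar>l\<bar> \<le> N"
    using assms finite_nat_set_iff_bounded_le[of "(\<lambda>l. nat \<bar>l\<bar>) ` L"] by auto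
  have "L \<subseteq> {- int (max 1 N)..int (max 1 N)}" using N by fastforce
  then show ?thesis by (intro exI[of _ "max 1 N"]) simp
qed

context completed_shift
begin

subsection \<open>Pressure of the compact subsystems\<close>

lemma conc_in_bounded_seqs_iff:
  assumes "x \<in> bounded_seqs N"
  shows "{c. length c = n \<and> c \<frown> x \<in> bounded_seqs N} = words (letters N) n"
proof -
  have "set c \<subseteq> letters N" if "c \<frown> x \<in> bounded_seqs N" for c
    using that unfolding bounded_seqs_iff_range range_conc by simp
  then show ?thesis using conc_in_bounded_seqs[OF _ assms] by (auto simp: words_def)
qed

lemma word_sum_eq_partition_sum:
  assumes "x \<in> bounded_seqs N"
  shows "word_sum \<phi> (letters N) n x = ennreal (partition_sum \<phi> N n x)"
  unfolding word_sum_def partition_sum_def conc_in_bounded_seqs_iff[OF assms]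
  by (simp add: finite_words infsum_finite sum_ennreal)

lemma partition_sum_pos:
  assumes "x \<in> bounded_seqs N"
  shows "partition_sum \<phi> N n x > 0"
proof -
  have "replicate n 0 \<in> words (letters N) n" by (auto simp: words_def)
  then show ?thesis
    unfolding partition_sum_def conc_in_bounded_seqs_iff[OF assms]
    by (intro sum_pos finite_words) auto
qed

lemma partition_sum_le:
  assumes "x \<in> bounded_seqs N" "N \<ge> 1"
  shows "partition_sum \<phi> N n x \<le> pre_bound ^ n"
proof -
  have "ennreal (partition_sum \<phi> N n x) \<le> word_sum \<phi> UNIV n x"
    unfolding word_sum_eq_partition_sum[OF assms(1), symmetric] by (rule word_sum_mono) simp
  also have "\<dots> \<le> ennreal (pre_bound ^ n)" by (rule word_sum_le) (use assms bounded_seqs_in in auto)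
  finally show ?thesis using pre_bound_pos by (simp add: ennreal_le_iff)
qed

text \<open>The \<open>j\<close>-th shift is continuous on the completion, so the shifted sequences
  converge too, and first letter separation applies to them.\<close>

lemma coords_of_limit:
  assumes N: "N \<ge> 1" and x: "\<And>i. x i \<in> bounded_seqs N" and l: "l \<in> bounded_seqs N"
    and lim: "limitin X.mtopology x l sequentially"
  shows "\<forall>\<^sub>F i in sequentially. x i j = l j"
proof -
  obtain \<gamma> where \<gamma>: "\<gamma> > 0"
    "\<And>x y. x \<in> bounded_seqs N \<Longrightarrow> y \<in> bounded_seqs N \<Longrightarrow> d x y < \<gamma> \<Longrightarrow> x 0 = y 0"
    using first_letter_separation[OF N] by blast
  have X: "x i \<in> X" "l \<in> X" for i using x l bounded_seqs_in[OF N] by auto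
  have "conv (\<lambda>i. \<iota> (x i)) (\<iota> l)"
    using lim X unfolding X.limitin_metric_dist_null by (simp add: conv_iff)
  then have "conv (\<lambda>i. \<iota> ((shift ^^ j) (x i))) (\<iota> ((shift ^^ j) l))"
    using conv_\<sigma>bar_funpow[of "\<lambda>i. \<iota> (x i)" "\<iota> l" j] X by (simp add: \<sigma>bar_funpow_\<iota>)
  then have "(\<lambda>i. d ((shift ^^ j) (x i)) ((shift ^^ j) l)) \<longlonglongrightarrow> 0"
    using X by (simp add: conv_iff)
  then have "\<forall>\<^sub>F i in sequentially. d ((shift ^^ j) (x i)) ((shift ^^ j) l) < \<gamma>"
    using \<gamma>(1) by (rule order_tendstoD)
  then show ?thesis
  proof eventually_elim
    case (elim i)
    have "(shift ^^ j) z \<in> bounded_seqs N" if "z \<in> bounded_seqs N" for z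
      by (rule funpow_in[OF shift_in_bounded_seqs that])
    then have "(shift ^^ j) (x i) 0 = (shift ^^ j) l 0" using \<gamma>(2) elim x l by blast
    then show ?case by (simp add: shift_funpow)
  qed
qed

text \<open>On \<open>bounded_seqs N\<close> the metric topology is the product topology.\<close>

lemma prefix_close:
  assumes N: "N \<ge> 1" and e: "e > 0"
  shows "\<exists>k. \<forall>x\<in>bounded_seqs N. \<forall>y\<in>bounded_seqs N. (\<forall>j<k. x j = y j) \<longrightarrow> d x y < e"
proof (rule ccontr)
  assume "\<not> ?thesis"
  then have "\<forall>k. \<exists>x y. x \<in> bounded_seqs N \<and> y \<in> bounded_seqs N \<and> (\<forall>j<k. x j = y j) \<and> d x y \<ge> e"
    by (metis not_le)
  then obtain x y where xy: "\<And>k. x k \<in> bounded_seqs N" "\<And>k. y k \<in> bounded_seqs N"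
      "\<And>k j. j < k \<Longrightarrow> x k j = y k j" "\<And>k. d (x k) (y k) \<ge> e"
    by metis
  have comp: "\<exists>l s. l \<in> bounded_seqs N \<and> strict_mono s \<and> limitin X.mtopology (z \<circ> s) l sequentially"
    if "\<And>k. z k \<in> bounded_seqs N" for z :: "nat \<Rightarrow> nat \<Rightarrow> int"
    using bounded_compact[OF N] that unfolding mtopology_of_def X.compactin_sequentially
    by (meson image_subset_iff)
  obtain l s where l: "l \<in> bounded_seqs N" "strict_mono s" "limitin X.mtopology (x \<circ> s) l sequentially"
    using comp[of x] xy(1) by blast
  obtain l' t where l': "l' \<in> bounded_seqs N" "strict_mono t"
    "limitin X.mtopology ((y \<circ> s) \<circ> t) l' sequentially"
    using comp[of "y \<circ> s"] xy(2) by auto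
  \<comment> \<open>A common subsequence along which both \<open>x\<close> and \<open>y\<close>
    converge.\<close>
  define u where "u = (\<lambda>i. s (t i))"
  have u: "strict_mono u" using l l' by (simp add: u_def strict_mono_def)
  have xl: "limitin X.mtopology (\<lambda>i. x (u i)) l sequentially"
    using limitin_subsequence[OF l'(2) l(3)] by (simp add: o_def u_def)
  have yl: "limitin X.mtopology (\<lambda>i. y (u i)) l' sequentially"
    using l'(3) by (simp add: o_def u_def)
  \<comment> \<open>The two sequences agree on prefixes of growing length, so every coordinate of
    their limits agrees. Equal limits contradict the distance \<open>e\<close> kept between
    them.\<close>
  have "l j = l' j" for j
  proof -
    have "\<forall>\<^sub>F i in sequentially. x (u i) j = l j" "\<forall>\<^sub>F i in sequentially. y (u i) j = l' j"
      by (rule coords_of_limit[OF N _ l(1) xl], rule xy, rule coords_of_limit[OF N _ l'(1) yl], rule xy)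
    moreover have "\<forall>\<^sub>F i in sequentially. i > j" by (rule eventually_gt_at_top)
    ultimately have "\<forall>\<^sub>F i in sequentially. l j = l' j"
    proof eventually_elim
      case (elim i)
      have "j < u i" using elim seq_suble[OF u, of i] by simp
      then show ?case using xy(3)[of j "u i"] elim by simp
    qed
    then show ?thesis by simp
  qed
  then have "l = l'" by auto
  moreover have "(\<lambda>i. d (x (u i)) l) \<longlonglongrightarrow> 0" "(\<lambda>i. d (y (u i)) l') \<longlonglongrightarrow> 0"
    using xl yl unfolding X.limitin_metric_dist_null by auto
  ultimately have "(\<lambda>i. d (x (u i)) l + d (y (u i)) l) \<longlonglongrightarrow> 0 + 0"
    by (intro tendsto_add) auto
  then have "\<forall>\<^sub>F i in sequentially. d (x (u i)) l + d (y (u i)) l < e"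
    by (rule order_tendstoD) (use e in simp)
  then obtain i where i: "d (x (u i)) l + d (y (u i)) l < e" by (auto simp: eventually_sequentially)
  have "x (u i) \<in> X" "y (u i) \<in> X" "l \<in> X" using xy l bounded_seqs_in[OF N] by auto
  then show False
    using X.triangle[of "x (u i)" l "y (u i)"] X.commute[of l "y (u i)"] xy(4)[of "u i"] i by simp
qed

text \<open>Prepending the first \<open>k\<close> letters of \<open>y\<close> to \<open>x\<close>
  gives a point within \<open>\<delta>\<^sub>1\<close> of \<open>y\<close>. The \<open>k\<close>
  additional letters cost bounded factors, uniformly in \<open>n\<close>.\<close>

lemma partition_sum_comparable:
  assumes N: "N \<ge> 1"
  shows "\<exists>c\<ge>0. \<forall>x\<in>bounded_seqs N. \<forall>y\<in>bounded_seqs N. \<forall>n.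
    partition_sum \<phi> N n y \<le> exp c * partition_sum \<phi> N n x"
proof -
  let ?A = "letters N"
  obtain k where k: "\<And>x y. x \<in> bounded_seqs N \<Longrightarrow> y \<in> bounded_seqs N \<Longrightarrow> (\<forall>j<k. x j = y j) \<Longrightarrow> d x y < \<delta>\<^sub>1"
    using prefix_close[OF N \<delta>\<^sub>1_pos] by blast
  have "X.mbounded (bounded_seqs N)"
    using bounded_compact[OF N] X.compactin_imp_mbounded by (simp add: mtopology_of_def)
  then obtain R where R: "R > 0" "\<And>z. z \<in> bounded_seqs N \<Longrightarrow> d zero_seq z \<le> R"
    unfolding X.mbounded_alt_pos using zero_seq_in_bounded_seqs by blast
  obtain B where B: "\<And>z. z \<in> X \<Longrightarrow> d zero_seq z \<le> R \<Longrightarrow> \<bar>birkhoff_sum \<phi> k z\<bar> \<le> B"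
    using birkhoff_sum_bounded[OF R(1)] by blast
  \<comment> \<open>The absolute value provides \<open>c \<ge> 0\<close>, as the statement
    demands.\<close>
  define c where "c = \<bar>dist_const + B + real k * ln pre_bound\<bar>"
  have "partition_sum \<phi> N n y \<le> exp c * partition_sum \<phi> N n x"
    if x: "x \<in> bounded_seqs N" and y: "y \<in> bounded_seqs N" for x y n
  proof -
    have X: "x \<in> X" "y \<in> X" using x y bounded_seqs_in[OF N] by auto
    define w where "w = prefix k y"
    have w: "set w \<subseteq> ?A" "length w = k" using y by (auto simp: w_def bounded_seqs_def)
    have wx: "w \<frown> x \<in> bounded_seqs N" by (rule conc_in_bounded_seqs[OF w(1) x])
    have "d (w \<frown> x) y < \<delta>\<^sub>1" by (rule k[OF wx y]) (simp add: w_def)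
    then have "word_sum \<phi> ?A n y \<le> ennreal (exp (dist_const - birkhoff_sum \<phi> k (w \<frown> x))) * word_sum \<phi> ?A (n + k) x"
      using word_sum_le_word_sum_reach[OF X(2) X(1) _ w(1)] w(2) by blast
    also have "\<dots> \<le> ennreal (exp (dist_const + B)) * (ennreal (pre_bound ^ k) * word_sum \<phi> ?A n x)"
    proof (intro mult_mono ennreal_leI)
      show "exp (dist_const - birkhoff_sum \<phi> k (w \<frown> x)) \<le> exp (dist_const + B)"
        using B[of "w \<frown> x"] R(2)[OF wx] X by simp
      \<comment> \<open>Written as \<open>k + n\<close>, the splitting puts the surplus
        \<open>k\<close> letters into the inner sum, where \<open>word_sum_le\<close> bounds them
        uniformly.\<close>
      have "word_sum \<phi> ?A (k + n) x \<le> (\<Sum>\<^sub>\<infinity>c\<in>words ?A n. ennreal (pre_bound ^ k) * ennreal (exp (birkhoff_sum \<phi> n (c \<frown> x))))"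
        unfolding word_sum_add
      proof (rule infsum_ennreal_mono)
        fix c
        have "word_sum \<phi> ?A k (c \<frown> x) \<le> ennreal (pre_bound ^ k)"
          by (rule order_trans[OF word_sum_mono word_sum_le]) (use X in auto)
        then show "ennreal (exp (birkhoff_sum \<phi> n (c \<frown> x))) * word_sum \<phi> ?A k (c \<frown> x)
            \<le> ennreal (pre_bound ^ k) * ennreal (exp (birkhoff_sum \<phi> n (c \<frown> x)))"
          by (subst mult.commute) (rule mult_right_mono, auto)
      qed
      also have "\<dots> = ennreal (pre_bound ^ k) * word_sum \<phi> ?A n x" unfolding word_sum_def infsum_ennreal_cmult ..
      finally show "word_sum \<phi> ?A (n + k) x \<le> ennreal (pre_bound ^ k) * word_sum \<phi> ?A n x" by (simp add: add.commute)
    qed auto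
    finally have "ennreal (partition_sum \<phi> N n y) \<le> ennreal (exp (dist_const + B) * (pre_bound ^ k * partition_sum \<phi> N n x))"
      using pre_bound_pos partition_sum_pos[OF x, of n] by (simp add: word_sum_eq_partition_sum x y ennreal_mult)
    then have "partition_sum \<phi> N n y \<le> exp (dist_const + B) * pre_bound ^ k * partition_sum \<phi> N n x"
      using pre_bound_pos partition_sum_pos[OF x, of n] by (subst (asm) ennreal_le_iff) (auto simp: mult_ac)
    also have "exp (dist_const + B) * pre_bound ^ k = exp (dist_const + B + real k * ln pre_bound)"
      using pre_bound_pos by (simp add: exp_add exp_of_nat_mult)
    also have "exp (dist_const + B + real k * ln pre_bound) * partition_sum \<phi> N n x \<le> exp c * partition_sum \<phi> N n x"
      using partition_sum_pos[OF x, of n] by (intro mult_right_mono) (auto simp: c_def)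
    finally show ?thesis .
  qed
  then show ?thesis by (intro exI[of _ c]) (auto simp: c_def)
qed

text \<open>Comparability of base points makes the partition sums at \<open>zero_seq\<close>
  supermultiplicative up to the factor \<open>exp c\<close>, so their logarithms minus
  \<open>c\<close> are superadditive. Other base points change the logarithm by at most
  \<open>c\<close>.\<close>

lemma top_pressure_limit:
  assumes N: "N \<ge> 1"
  shows "\<forall>x\<in>bounded_seqs N. (\<lambda>n. ln (partition_sum \<phi> N n x) / real n) \<longlonglongrightarrow> top_pressure \<phi> N"
proof -
  let ?A = "letters N"
  let ?p = "\<lambda>n. partition_sum \<phi> N n zero_seq"
  note z = zero_seq_in_bounded_seqs[of N]
  obtain c where c: "c \<ge> 0" "\<And>x y n. x \<in> bounded_seqs N \<Longrightarrow> y \<in> bounded_seqs N \<Longrightarrow>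
      partition_sum \<phi> N n y \<le> exp c * partition_sum \<phi> N n x"
    using partition_sum_comparable[OF N] by blast
  have lnc: "ln (partition_sum \<phi> N n y) \<le> c + ln (partition_sum \<phi> N n x)"
    if "x \<in> bounded_seqs N" "y \<in> bounded_seqs N" for x y n
  proof -
    have "ln (partition_sum \<phi> N n y) \<le> ln (exp c * partition_sum \<phi> N n x)"
      using c(2)[OF that, of n] partition_sum_pos that by (subst ln_le_cancel_iff) auto
    then show ?thesis using partition_sum_pos[OF that(1), of n] by (simp add: ln_mult)
  qed
  have mult: "?p i * ?p n \<le> exp c * ?p (i + n)" for i n
  proof -
    have "word_sum \<phi> ?A i zero_seq * word_sum \<phi> ?A n zero_seq
      = (\<Sum>\<^sub>\<infinity>w\<in>words ?A n. word_sum \<phi> ?A i zero_seq * ennreal (exp (birkhoff_sum \<phi> n (w \<frown> zero_seq))))"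
      unfolding infsum_ennreal_cmult by (simp add: word_sum_def)
    also have "\<dots> \<le> (\<Sum>\<^sub>\<infinity>w\<in>words ?A n. ennreal (exp c) *
        (ennreal (exp (birkhoff_sum \<phi> n (w \<frown> zero_seq))) * word_sum \<phi> ?A i (w \<frown> zero_seq)))"
    proof (rule infsum_ennreal_mono)
      fix w assume "w \<in> words ?A n"
      then have wz: "w \<frown> zero_seq \<in> bounded_seqs N"
        using conc_in_bounded_seqs[OF _ z] by (simp add: words_def)
      have "word_sum \<phi> ?A i zero_seq \<le> ennreal (exp c) * word_sum \<phi> ?A i (w \<frown> zero_seq)"
        using c(2)[OF wz z, of i] partition_sum_pos[OF wz, of i]
        by (simp add: word_sum_eq_partition_sum z wz ennreal_mult[symmetric] ennreal_leI)
      then have "word_sum \<phi> ?A i zero_seq * ennreal (exp (birkhoff_sum \<phi> n (w \<frown> zero_seq)))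
        \<le> ennreal (exp c) * word_sum \<phi> ?A i (w \<frown> zero_seq) * ennreal (exp (birkhoff_sum \<phi> n (w \<frown> zero_seq)))"
        by (rule mult_right_mono) simp
      then show "word_sum \<phi> ?A i zero_seq * ennreal (exp (birkhoff_sum \<phi> n (w \<frown> zero_seq)))
        \<le> ennreal (exp c) * (ennreal (exp (birkhoff_sum \<phi> n (w \<frown> zero_seq))) * word_sum \<phi> ?A i (w \<frown> zero_seq))"
        by (simp add: mult_ac)
    qed
    also have "\<dots> = ennreal (exp c) * word_sum \<phi> ?A (i + n) zero_seq" unfolding infsum_ennreal_cmult word_sum_add ..
    finally have "ennreal (?p i * ?p n) \<le> ennreal (exp c * ?p (i + n))"
      using partition_sum_pos[OF z] by (simp add: word_sum_eq_partition_sum z ennreal_mult less_imp_le)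
    then show ?thesis using partition_sum_pos[OF z, of "i + n"] by (subst (asm) ennreal_le_iff) auto
  qed
  obtain L where L: "(\<lambda>n. (ln (?p n) - c) / real n) \<longlonglongrightarrow> L"
  proof -
    have "\<exists>L. (\<lambda>n. (ln (?p n) - c) / real n) \<longlonglongrightarrow> L"
    proof (rule superadditive_limit[where B = "ln pre_bound"])
      fix i n
      have "ln (?p i * ?p n) \<le> ln (exp c * ?p (i + n))"
        using mult[of i n] partition_sum_pos[OF z] by (subst ln_le_cancel_iff) auto
      then show "ln (?p i) - c + (ln (?p n) - c) \<le> ln (?p (i + n)) - c"
        using partition_sum_pos[OF z, of i] partition_sum_pos[OF z, of n]
          partition_sum_pos[OF z, of "i + n"] by (simp add: ln_mult)
    next
      fix n
      have "ln (?p n) \<le> ln (pre_bound ^ n)"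
        using partition_sum_le[OF z N, of n] partition_sum_pos[OF z, of n] pre_bound_pos by (subst ln_le_cancel_iff) auto
      then show "ln (?p n) - c \<le> ln pre_bound * real n" using c(1) pre_bound_pos by (simp add: ln_realpow mult.commute)
    qed
    then show ?thesis using that by blast
  qed
  have conv: "(\<lambda>n. ln (partition_sum \<phi> N n x) / real n) \<longlonglongrightarrow> L" if x: "x \<in> bounded_seqs N" for x
  proof (rule tendsto_sandwich)
    show "\<forall>\<^sub>F n in sequentially. (ln (?p n) - c) / real n \<le> ln (partition_sum \<phi> N n x) / real n"
    proof (rule always_eventually, rule allI)
      fix n show "(ln (?p n) - c) / real n \<le> ln (partition_sum \<phi> N n x) / real n"
        using lnc[OF x z, of n] by (intro divide_right_mono) auto
    qed
    \<comment> \<open>One \<open>c\<close> restores the subtracted constant, the other pays for the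
      change of base point.\<close>
    show "\<forall>\<^sub>F n in sequentially. ln (partition_sum \<phi> N n x) / real n \<le> (ln (?p n) - c) / real n + 2 * c / real n"
    proof (rule always_eventually, rule allI)
      fix n show "ln (partition_sum \<phi> N n x) / real n \<le> (ln (?p n) - c) / real n + 2 * c / real n"
        unfolding add_divide_distrib[symmetric] using lnc[OF z x, of n] by (intro divide_right_mono) auto
    qed
    have "(\<lambda>n. 2 * c / real n) \<longlonglongrightarrow> 0" by (rule lim_const_over_n)
    then show "(\<lambda>n. (ln (?p n) - c) / real n + 2 * c / real n) \<longlonglongrightarrow> L" using tendsto_add[OF L] by fastforce
    show "(\<lambda>n. (ln (?p n) - c) / real n) \<longlonglongrightarrow> L" by (fact L)
  qed
  \<comment> \<open>The definite description is legitimate: \<open>zero_seq\<close> is a reference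
    point, so limits at it are unique.\<close>
  have "top_pressure \<phi> N = L"
    unfolding top_pressure_def
    by (rule the_equality) (use conv z LIMSEQ_unique in blast)+
  then show ?thesis using conv by simp
qed

lemma top_pressure_le:
  assumes N: "N \<ge> 1"
  shows "top_pressure \<phi> N \<le> ln pre_bound"
proof -
  note z = zero_seq_in_bounded_seqs[of N]
  have "\<forall>n\<ge>1. ln (partition_sum \<phi> N n zero_seq) / real n \<le> ln pre_bound"
  proof (intro allI impI)
    fix n :: nat assume n: "n \<ge> 1"
    have "ln (partition_sum \<phi> N n zero_seq) \<le> ln (pre_bound ^ n)"
      using partition_sum_le[OF z N, of n] partition_sum_pos[OF z, of n] pre_bound_pos by (subst ln_le_cancel_iff) auto
    then show "ln (partition_sum \<phi> N n zero_seq) / real n \<le> ln pre_bound"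
      using n pre_bound_pos by (simp add: ln_realpow field_simps)
  qed
  then show ?thesis using top_pressure_limit[OF N] z LIMSEQ_le_const2 by blast
qed

text \<open>Words that bring the fixed point back close to itself can be concatenated freely, up to bounded
  distortion.\<close>

lemma sum_returning_words_le:
  assumes N: "N \<ge> 1" and F: "F \<subseteq> words (letters N) l"
    and ret: "\<And>c. c \<in> F \<Longrightarrow> d zero_seq (c \<frown> zero_seq) < \<delta>\<^sub>1"
  shows "(\<Sum>c\<in>F. exp (birkhoff_sum \<phi> l (c \<frown> zero_seq))) \<le> exp (dist_const + real l * top_pressure \<phi> N)"
proof -
  let ?A = "letters N"
  note z = zero_seq_in_bounded_seqs[of N]
  define Q where "Q = (\<Sum>c\<in>F. exp (birkhoff_sum \<phi> l (c \<frown> zero_seq)))"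
  have fin: "finite F" using F finite_words[of ?A l] finite_subset by blast
  have Q0: "Q \<ge> 0" unfolding Q_def by (rule sum_nonneg) auto
  have K0: "dist_const \<ge> 0" using dist_const[of zero_seq zero_seq "[]"] \<delta>\<^sub>1_pos by simp
  show ?thesis
  \<comment> \<open>The main case divides by \<open>l\<close> and takes \<open>ln Q\<close>. For
    \<open>l = 0\<close> only the empty word can occur, whose weight is 1.\<close>
  proof (cases "l = 0 \<or> Q = 0")
    case True
    have "Q \<le> exp dist_const" if "l = 0"
    proof -
      have "F \<subseteq> {[]}" using F that by (auto simp: words_def)
      then have "Q \<le> 1" using that by (auto simp: Q_def subset_singleton_iff)
      also have "1 \<le> exp dist_const" using K0 by simp
      finally show ?thesis .
    qed
    with True show ?thesis unfolding Q_def[symmetric] by auto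
  next
    case False
    then have l: "l > 0" and Q: "Q > 0" using Q0 by auto
    \<comment> \<open>Placing one more word of \<open>F\<close> next to the fixed point moves the
      base point by less than \<open>\<delta>\<^sub>1\<close>, so each of the \<open>q\<close>
      blocks costs one factor \<open>exp (- dist_const)\<close>.\<close>
    have step: "ennreal ((exp (- dist_const) * Q) ^ q) \<le> word_sum \<phi> ?A (q * l) zero_seq" for q
    proof (induction q)
      case (Suc q)
      have "ennreal ((exp (- dist_const) * Q) ^ Suc q) = ennreal (exp (- dist_const)) * ennreal Q * ennreal ((exp (- dist_const) * Q) ^ q)"
        using Q by (simp add: ennreal_mult)
      also have "\<dots> \<le> ennreal (exp (- dist_const)) * ennreal Q * word_sum \<phi> ?A (q * l) zero_seq"
        by (intro mult_left_mono Suc) auto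
      also have "\<dots> = (\<Sum>c\<in>F. ennreal (exp (birkhoff_sum \<phi> l (c \<frown> zero_seq))) *
          (ennreal (exp (- dist_const)) * word_sum \<phi> ?A (q * l) zero_seq))"
        unfolding sum_distrib_right[symmetric] by (simp add: Q_def sum_ennreal mult_ac)
      also have "\<dots> \<le> (\<Sum>c\<in>F. ennreal (exp (birkhoff_sum \<phi> l (c \<frown> zero_seq))) * word_sum \<phi> ?A (q * l) (c \<frown> zero_seq))"
      proof (intro sum_mono mult_left_mono)
        fix c assume "c \<in> F"
        then have "word_sum \<phi> ?A (q * l) zero_seq \<le> ennreal (exp dist_const) * word_sum \<phi> ?A (q * l) (c \<frown> zero_seq)"
          using ret by (intro word_sum_distortion) auto
        then have "ennreal (exp (- dist_const)) * word_sum \<phi> ?A (q * l) zero_seq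
            \<le> ennreal (exp (- dist_const)) * (ennreal (exp dist_const) * word_sum \<phi> ?A (q * l) (c \<frown> zero_seq))"
          by (rule mult_left_mono) simp
        then show "ennreal (exp (- dist_const)) * word_sum \<phi> ?A (q * l) zero_seq \<le> word_sum \<phi> ?A (q * l) (c \<frown> zero_seq)"
          by (simp add: mult.assoc[symmetric] ennreal_mult[symmetric] exp_add[symmetric])
      qed auto
      also have "\<dots> \<le> word_sum \<phi> ?A (q * l + l) zero_seq" by (rule word_sum_add_ge[OF fin F])
      finally show ?case by (simp add: add.commute)
    qed simp
    have ge: "(ln Q - dist_const) / real l \<le> ln (partition_sum \<phi> N (q * l) zero_seq) / real (q * l)" if "q \<ge> 1" for q
    proof -
      have "(exp (- dist_const) * Q) ^ q \<le> partition_sum \<phi> N (q * l) zero_seq"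
        using step[of q] partition_sum_pos[OF z, of "q * l"] unfolding word_sum_eq_partition_sum[OF z]
        by (subst (asm) ennreal_le_iff) auto
      then have "ln ((exp (- dist_const) * Q) ^ q) \<le> ln (partition_sum \<phi> N (q * l) zero_seq)"
        using Q partition_sum_pos[OF z] by (subst ln_le_cancel_iff) auto
      then have "real q * (ln Q - dist_const) \<le> ln (partition_sum \<phi> N (q * l) zero_seq)"
        using Q by (simp add: ln_realpow ln_mult)
      then have "real q * (ln Q - dist_const) / real (q * l) \<le> ln (partition_sum \<phi> N (q * l) zero_seq) / real (q * l)"
        by (rule divide_right_mono) simp
      then show ?thesis using that by simp
    qed
    \<comment> \<open>The limit defining the pressure is taken along the multiples of
      \<open>l\<close>.\<close>
    have "strict_mono (\<lambda>q. q * l)" using l by (simp add: strict_mono_def)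
    then have "(\<lambda>q. ln (partition_sum \<phi> N (q * l) zero_seq) / real (q * l)) \<longlonglongrightarrow> top_pressure \<phi> N"
      using LIMSEQ_subseq_LIMSEQ[OF top_pressure_limit[OF N, rule_format, OF z]] unfolding o_def by blast
    then have "(ln Q - dist_const) / real l \<le> top_pressure \<phi> N" using ge LIMSEQ_le_const by blast
    then have "ln Q \<le> dist_const + real l * top_pressure \<phi> N" using l by (simp add: field_simps)
    then have "exp (ln Q) \<le> exp (dist_const + real l * top_pressure \<phi> N)" by (subst exp_le_cancel_iff)
    then show ?thesis using Q by (simp add: Q_def[symmetric])
  qed
qed

subsection \<open>Upper bound for the transfer operator\<close>

text \<open>The pressure as a real number; \<open>top_pressure_le\<close> makes the supremum
  finite.\<close>

definition pressure_val :: real where "pressure_val = (SUP N\<in>{1..}. top_pressure \<phi> N)"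

lemma bdd_above_top_pressure: "bdd_above (top_pressure \<phi> ` {1..})"
  using top_pressure_le by (intro bdd_aboveI2[where M = "ln pre_bound"]) auto

lemma top_pressure_le_pressure_val: "N \<ge> 1 \<Longrightarrow> top_pressure \<phi> N \<le> pressure_val"
  unfolding pressure_val_def by (rule cSUP_upper[OF _ bdd_above_top_pressure]) simp

lemma less_pressure_val: "t < pressure_val \<Longrightarrow> \<exists>N\<ge>1. t < top_pressure \<phi> N"
  unfolding pressure_val_def using less_cSUP_iff[OF _ bdd_above_top_pressure] by auto

lemma pressure_eq: "pressure \<phi> = ereal pressure_val"
  unfolding pressure_def
proof (rule SUP_eqI)
  fix y assume y: "\<And>N. N \<in> {1..} \<Longrightarrow> ereal (top_pressure \<phi> N) \<le> y"
  show "ereal pressure_val \<le> y"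
  proof (cases y)
    case (real t)
    then have "pressure_val \<le> t" unfolding pressure_val_def by (intro cSUP_least) (use y in auto)
    then show ?thesis using real by simp
  qed (use y[of 1] in auto)
qed (use top_pressure_le_pressure_val in auto)

text \<open>Return words turn \<open>G\<close> into words that can be concatenated. Being finite,
  the new family uses the letters of some \<open>letters N\<close>; \<open>N\<close> depends on
  \<open>G\<close>, but the bound involves only the supremum over all \<open>N\<close>.\<close>

lemma sum_words_in_ball_le:
  assumes "R > 0"
  shows "\<exists>C. \<forall>n G. finite G \<longrightarrow> G \<subseteq> words UNIV n \<longrightarrow> (\<forall>c\<in>G. d zero_seq (c \<frown> zero_seq) < R) \<longrightarrow>
    (\<Sum>c\<in>G. exp (birkhoff_sum \<phi> n (c \<frown> zero_seq))) \<le> exp (C + real n * pressure_val)"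
proof -
  obtain k B where ret: "\<And>x. x \<in> X \<Longrightarrow> d zero_seq x < R \<Longrightarrow>
    \<exists>w. length w = k \<and> d zero_seq (w \<frown> x) < \<delta>\<^sub>1 \<and> \<bar>birkhoff_sum \<phi> k (w \<frown> x)\<bar> \<le> B"
    using return[OF assms \<delta>\<^sub>1_pos] by blast
  have "(\<Sum>c\<in>G. exp (birkhoff_sum \<phi> n (c \<frown> zero_seq))) \<le> exp (B + dist_const + real k * pressure_val + real n * pressure_val)"
    if G: "finite G" "G \<subseteq> words UNIV n" "\<And>c. c \<in> G \<Longrightarrow> d zero_seq (c \<frown> zero_seq) < R" for n G
  proof -
    have "\<forall>c\<in>G. \<exists>w. length w = k \<and> d zero_seq (w \<frown> c \<frown> zero_seq) < \<delta>\<^sub>1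
        \<and> \<bar>birkhoff_sum \<phi> k (w \<frown> c \<frown> zero_seq)\<bar> \<le> B"
    proof
      fix c assume "c \<in> G"
      then show "\<exists>w. length w = k \<and> d zero_seq (w \<frown> c \<frown> zero_seq) < \<delta>\<^sub>1
        \<and> \<bar>birkhoff_sum \<phi> k (w \<frown> c \<frown> zero_seq)\<bar> \<le> B"
        by (intro ret G(3)) (simp only: conc_in zero_in)
    qed
    then obtain w where w: "\<And>c. c \<in> G \<Longrightarrow> length (w c) = k"
        "\<And>c. c \<in> G \<Longrightarrow> d zero_seq (w c \<frown> c \<frown> zero_seq) < \<delta>\<^sub>1"
        "\<And>c. c \<in> G \<Longrightarrow> \<bar>birkhoff_sum \<phi> k (w c \<frown> c \<frown> zero_seq)\<bar> \<le> B"
      by metis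
    let ?f = "\<lambda>c. w c @ c"
    \<comment> \<open>All return words have length \<open>k\<close>, so \<open>c\<close> is
      recovered from \<open>w c @ c\<close>.\<close>
    have inj: "inj_on ?f G" by (rule inj_onI) (use w(1) in auto)
    have "finite (\<Union>c\<in>G. set (?f c))" using G(1) by auto
    then obtain N where N: "N \<ge> 1" "(\<Union>c\<in>G. set (?f c)) \<subseteq> letters N" using finite_int_bounded by metis
    have "exp (- B) * (\<Sum>c\<in>G. exp (birkhoff_sum \<phi> n (c \<frown> zero_seq)))
       \<le> (\<Sum>c\<in>G. exp (birkhoff_sum \<phi> (k + n) (?f c \<frown> zero_seq)))"
      unfolding sum_distrib_left exp_add[symmetric]
    proof (intro sum_mono, subst exp_le_cancel_iff)
      fix c assume c: "c \<in> G"
      show "- B + birkhoff_sum \<phi> n (c \<frown> zero_seq) \<le> birkhoff_sum \<phi> (k + n) (?f c \<frown> zero_seq)"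
        using birkhoff_sum_conc_append[of \<phi> "w c" n "c \<frown> zero_seq"] w(1)[OF c] w(3)[OF c] by simp
    qed
    also have "\<dots> = (\<Sum>c\<in>?f ` G. exp (birkhoff_sum \<phi> (k + n) (c \<frown> zero_seq)))"
      by (simp add: sum.reindex[OF inj])
    also have "\<dots> \<le> exp (dist_const + real (k + n) * top_pressure \<phi> N)"
    proof (rule sum_returning_words_le[OF N(1)])
      show "?f ` G \<subseteq> words (letters N) (k + n)" using N(2) w(1) G(2) by (fastforce simp: words_def)
    qed (use w(2) in auto)
    also have "\<dots> \<le> exp (dist_const + real (k + n) * pressure_val)"
      using top_pressure_le_pressure_val[OF N(1)] by (simp add: mult_left_mono)
    finally have "exp B * (exp (- B) * (\<Sum>c\<in>G. exp (birkhoff_sum \<phi> n (c \<frown> zero_seq))))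
        \<le> exp B * exp (dist_const + real (k + n) * pressure_val)" by (rule mult_left_mono) simp
    then show ?thesis
      by (simp add: mult.assoc[symmetric] exp_add[symmetric] algebra_simps)
  qed
  then show ?thesis by (intro exI[of _ "B + dist_const + real k * pressure_val"]) blast
qed

text \<open>The sum over one letter is dominated by the operator on the completion, so it inherits
  the rapid decrease.\<close>

lemma small_outside_ball:
  assumes "e > 0"
  shows "\<exists>R>0. \<forall>x\<in>X. d zero_seq x \<ge> R \<longrightarrow> word_sum \<phi> UNIV 1 x \<le> ennreal e"
proof -
  have "\<forall>\<^sub>F R in at_top. (SUP a\<in>Y - mball_of M (\<iota> zero_seq) R. transfer_op Y \<sigma>bar \<phi>bar (\<lambda>_. 1) a) < ennreal e"
    using rapidly_decreasing by (rule order_tendstoD) (use assms in simp)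
  moreover have "\<forall>\<^sub>F R :: real in at_top. R > 0" by (rule eventually_gt_at_top)
  ultimately have "\<forall>\<^sub>F R in at_top. R > 0 \<and>
      (SUP a\<in>Y - mball_of M (\<iota> zero_seq) R. transfer_op Y \<sigma>bar \<phi>bar (\<lambda>_. 1) a) < ennreal e"
    by eventually_elim simp
  then obtain R where R: "R > 0"
    "(SUP a\<in>Y - mball_of M (\<iota> zero_seq) R. transfer_op Y \<sigma>bar \<phi>bar (\<lambda>_. 1) a) < ennreal e"
    by (auto dest: eventually_happens)
  have "word_sum \<phi> UNIV 1 x \<le> ennreal e" if x: "x \<in> X" "d zero_seq x \<ge> R" for x
  proof -
    have "word_sum \<phi> UNIV 1 x \<le> iter_one 1 (\<iota> x)" by (rule word_sum_le_iter_one) fact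
    also have "iter_one 1 (\<iota> x) = transfer_op Y \<sigma>bar \<phi>bar (\<lambda>_. 1) (\<iota> x)" by (simp add: iter_one_def)
    also have "\<dots> \<le> (SUP a\<in>Y - mball_of M (\<iota> zero_seq) R. transfer_op Y \<sigma>bar \<phi>bar (\<lambda>_. 1) a)"
      by (rule SUP_upper) (use x in auto)
    finally show ?thesis using R(2) by simp
  qed
  with R(1) show ?thesis by blast
qed

text \<open>A new letter is prepended to a word \<open>c\<close> of length \<open>n\<close>. If
  \<open>c \<frown> zero_seq\<close> lies in the ball, \<open>sum_words_in_ball_le\<close> controls
  the weight of \<open>c\<close>; otherwise the new letter gains the factor
  \<open>e\<close>.\<close>

lemma word_sum_zero_le: "\<exists>C. \<forall>n. word_sum \<phi> UNIV n zero_seq \<le> ennreal (exp (C + real n * pressure_val))"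
proof -
  \<comment> \<open>After division by \<open>exp (real n * pressure_val)\<close> this makes the
    recursion for the word sums a contraction by one half.\<close>
  define e where "e = exp pressure_val / 2"
  have "e > 0" by (simp add: e_def)
  then obtain R where R: "R > 0" "\<And>x. x \<in> X \<Longrightarrow> d zero_seq x \<ge> R \<Longrightarrow> word_sum \<phi> UNIV 1 x \<le> ennreal e"
    using small_outside_ball by blast
  obtain C where C: "\<forall>n G. finite G \<longrightarrow> G \<subseteq> words UNIV n \<longrightarrow> (\<forall>c\<in>G. d zero_seq (c \<frown> zero_seq) < R) \<longrightarrow>
    (\<Sum>c\<in>G. exp (birkhoff_sum \<phi> n (c \<frown> zero_seq))) \<le> exp (C + real n * pressure_val)"
    using sum_words_in_ball_le[OF R(1)] by (elim exE)
  let ?E = "\<lambda>n c. ennreal (exp (birkhoff_sum \<phi> n (c \<frown> zero_seq)))"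
  have rec: "word_sum \<phi> UNIV (1 + n) zero_seq
      \<le> ennreal pre_bound * ennreal (exp (C + real n * pressure_val)) + ennreal e * word_sum \<phi> UNIV n zero_seq" for n
  proof -
    define I where "I = {c \<in> words UNIV n. d zero_seq (c \<frown> zero_seq) < R}"
    have split: "words UNIV n = I \<union> (words UNIV n - I)" by (auto simp: I_def)
    have "word_sum \<phi> UNIV (1 + n) zero_seq
      = (\<Sum>\<^sub>\<infinity>c\<in>I. ?E n c * word_sum \<phi> UNIV 1 (c \<frown> zero_seq))
        + (\<Sum>\<^sub>\<infinity>c\<in>words UNIV n - I. ?E n c * word_sum \<phi> UNIV 1 (c \<frown> zero_seq))"
      unfolding word_sum_add by (subst split, rule infsum_Un_disjoint) (auto intro!: nonneg_summable_on_complete)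
    also have "(\<Sum>\<^sub>\<infinity>c\<in>I. ?E n c * word_sum \<phi> UNIV 1 (c \<frown> zero_seq)) \<le> (\<Sum>\<^sub>\<infinity>c\<in>I. ennreal pre_bound * ?E n c)"
      by (intro infsum_ennreal_mono, subst mult.commute) (intro mult_right_mono word_sum_1_le, auto)
    also have "\<dots> = ennreal pre_bound * (\<Sum>\<^sub>\<infinity>c\<in>I. ?E n c)" by (rule infsum_ennreal_cmult)
    also have "(\<Sum>\<^sub>\<infinity>c\<in>I. ?E n c) \<le> ennreal (exp (C + real n * pressure_val))"
    proof (rule infsum_ennreal_leI)
      fix G assume "finite G" "G \<subseteq> I"
      then have "(\<Sum>c\<in>G. exp (birkhoff_sum \<phi> n (c \<frown> zero_seq))) \<le> exp (C + real n * pressure_val)"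
        by (intro C[rule_format]) (auto simp: I_def)
      then show "sum (?E n) G \<le> ennreal (exp (C + real n * pressure_val))" by (simp add: sum_ennreal ennreal_leI)
    qed
    also have "(\<Sum>\<^sub>\<infinity>c\<in>words UNIV n - I. ?E n c * word_sum \<phi> UNIV 1 (c \<frown> zero_seq))
        \<le> (\<Sum>\<^sub>\<infinity>c\<in>words UNIV n - I. ennreal e * ?E n c)"
      by (intro infsum_ennreal_mono, subst mult.commute) (intro mult_right_mono R(2), auto simp: I_def)
    also have "\<dots> = ennreal e * (\<Sum>\<^sub>\<infinity>c\<in>words UNIV n - I. ?E n c)" by (rule infsum_ennreal_cmult)
    also have "(\<Sum>\<^sub>\<infinity>c\<in>words UNIV n - I. ?E n c) \<le> word_sum \<phi> UNIV n zero_seq"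
      unfolding word_sum_def by (rule infsum_ennreal_mono_set) auto
    finally show ?thesis by (simp add: add_mono mult_left_mono)
  qed
  \<comment> \<open>In the induction step each of the two terms is at most half of the claimed
    bound: the first by the choice of \<open>D'\<close>, the second by the choice of
    \<open>e\<close>. The maximum with 1 covers \<open>n = 0\<close>.\<close>
  define D' where "D' = max 1 (2 * pre_bound * exp (C - pressure_val))"
  have "word_sum \<phi> UNIV n zero_seq \<le> ennreal (D' * exp (real n * pressure_val))" for n
  proof (induction n)
    case 0
    then show ?case by (simp add: D'_def)
  next
    case (Suc n)
    have "word_sum \<phi> UNIV (Suc n) zero_seq
        \<le> ennreal pre_bound * ennreal (exp (C + real n * pressure_val)) + ennreal e * ennreal (D' * exp (real n * pressure_val))"
      using rec[of n] Suc by (simp add: order_trans[OF _ add_left_mono[OF mult_left_mono[OF Suc]]])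
    also have "\<dots> = ennreal (pre_bound * exp (C + real n * pressure_val) + e * (D' * exp (real n * pressure_val)))"
      using pre_bound_pos \<open>e > 0\<close> by (subst ennreal_plus) (auto simp: ennreal_mult D'_def)
    also have "\<dots> \<le> ennreal (D' * exp (real (Suc n) * pressure_val))"
    proof (rule ennreal_leI)
      have "pre_bound * exp (C + real n * pressure_val) = (pre_bound * exp (C - pressure_val)) * exp (real (Suc n) * pressure_val)"
        by (simp add: exp_add[symmetric] algebra_simps)
      also have "\<dots> \<le> D' / 2 * exp (real (Suc n) * pressure_val)"
        by (intro mult_right_mono) (auto simp: D'_def)
      moreover have "e * (D' * exp (real n * pressure_val)) = D' / 2 * exp (real (Suc n) * pressure_val)"
        by (simp add: e_def exp_add[symmetric] algebra_simps)
      ultimately show "pre_bound * exp (C + real n * pressure_val) + e * (D' * exp (real n * pressure_val)) \<le> D' * exp (real (Suc n) * pressure_val)"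
        by linarith
    qed
    finally show ?case .
  qed
  moreover have "D' * exp (real n * pressure_val) = exp (ln D' + real n * pressure_val)" for n
    by (simp add: exp_add D'_def)
  ultimately show ?thesis by auto
qed

text \<open>Pass from \<open>a\<close> to a nearby point of \<open>X\<close>, then to the fixed
  point; the \<open>k\<close> extra letters only change the constant.\<close>

lemma iter_one_le_exp:
  assumes a: "a \<in> Y"
  shows "\<exists>C. \<forall>n. iter_one n a \<le> ennreal (exp (C + real n * pressure_val))"
proof -
  obtain y where y: "y \<in> X" "D a (\<iota> y) < \<delta>\<^sub>1" using dense_near[OF a \<delta>\<^sub>1_pos] by blast
  obtain k c where kc: "\<And>n. word_sum \<phi> UNIV n y \<le> ennreal (exp c) * word_sum \<phi> UNIV (n + k) zero_seq"
    using word_sum_le_word_sum_zero[OF y(1)] by blast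
  obtain C where C: "\<And>n. word_sum \<phi> UNIV n zero_seq \<le> ennreal (exp (C + real n * pressure_val))" using word_sum_zero_le by blast
  have "iter_one n a \<le> ennreal (exp (dist_const + c + C + real k * pressure_val + real n * pressure_val))" for n
  proof -
    have "iter_one n a \<le> ennreal (exp dist_const) * word_sum \<phi> UNIV n y" by (rule iter_one_le[OF a y])
    also have "\<dots> \<le> ennreal (exp dist_const) * (ennreal (exp c) * ennreal (exp (C + real (n + k) * pressure_val)))"
      by (intro mult_left_mono order_trans[OF kc] C) auto
    also have "\<dots> = ennreal (exp (dist_const + c + C + real k * pressure_val + real n * pressure_val))"
      by (simp add: ennreal_mult[symmetric] exp_add[symmetric] algebra_simps)
    finally show ?thesis .
  qed
  then show ?thesis by blast
qed

section \<open>Exponential growth rate of the iterates at an arbitrary point\<close>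

lemma iter_one_limit:
  assumes a: "a \<in> Y"
  shows "(\<lambda>n. eln (iter_one n a) / ereal (real n)) \<longlonglongrightarrow> ereal pressure_val"
proof -
  define v where "v = (\<lambda>n. enn2real (iter_one n a))"
  obtain C where C: "\<And>n. iter_one n a \<le> ennreal (exp (C + real n * pressure_val))" using iter_one_le_exp[OF a] by blast
  \<comment> \<open>The exponential upper bound makes every iterate finite, so real logarithms can
    be used.\<close>
  have Uv: "iter_one n a = ennreal (v n)" for n
    using le_less_trans[OF C ennreal_less_top] by (simp add: v_def)
  have v0: "v n \<ge> 0" for n by (simp add: v_def)
  have v_le: "v n \<le> exp (C + real n * pressure_val)" for n using C[of n] by (simp add: Uv)
  have lower: "\<exists>k c. \<forall>n. 0 < v (n + k) \<and> ln (partition_sum \<phi> N n zero_seq) - c \<le> ln (v (n + k))"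
    if N: "N \<ge> 1" for N
  proof -
    note z = zero_seq_in_bounded_seqs[of N]
    obtain k c where kc: "\<And>n. word_sum \<phi> (letters N) n zero_seq \<le> ennreal (exp c) * iter_one (n + k) a"
      using iter_one_ge[OF N a] by blast
    have "0 < v (n + k) \<and> ln (partition_sum \<phi> N n zero_seq) - c \<le> ln (v (n + k))" for n
    proof -
      have le: "partition_sum \<phi> N n zero_seq \<le> exp c * v (n + k)"
        using kc[of n] v0[of "n + k"] by (simp add: Uv word_sum_eq_partition_sum z ennreal_mult[symmetric])
      moreover have pos: "0 < partition_sum \<phi> N n zero_seq" by (rule partition_sum_pos[OF z])
      ultimately have "0 < exp c * v (n + k)" by linarith
      then have v: "0 < v (n + k)" by (simp add: zero_less_mult_iff)
      have "ln (partition_sum \<phi> N n zero_seq) \<le> ln (exp c * v (n + k))"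
        using le pos by (subst ln_le_cancel_iff) auto
      then show ?thesis using v by (simp add: ln_mult)
    qed
    then show ?thesis by blast
  qed
  \<comment> \<open>Positivity is established from \<open>k0\<close> on, which suffices for the
    limit; before that \<open>eln\<close> might be \<open>-\<infinity>\<close>.\<close>
  obtain k0 where k0: "\<And>n. 0 < v (n + k0)" using lower[of 1] by auto
  have vpos: "0 < v n" if "n \<ge> k0" for n using k0[of "n - k0"] that by simp
  have "(\<lambda>n. ln (v n) / real n) \<longlonglongrightarrow> pressure_val"
  proof (rule order_tendstoI)
    fix t assume "t < pressure_val"
    then obtain N where N: "N \<ge> 1" "t < top_pressure \<phi> N" using less_pressure_val by blast
    obtain k c where kc: "\<And>n. ln (partition_sum \<phi> N n zero_seq) - c \<le> ln (v (n + k))"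
      using lower[OF N(1)] by blast
    have lim: "(\<lambda>n. ln (partition_sum \<phi> N n zero_seq) / real n) \<longlonglongrightarrow> top_pressure \<phi> N"
      using top_pressure_limit[OF N(1)] zero_seq_in_bounded_seqs by blast
    \<comment> \<open>The lower bound for index \<open>n + k\<close> comes from the partition sum of
      index \<open>n\<close>; the term \<open>t * real k\<close> compensates for dividing by
      \<open>n + k\<close>.\<close>
    have "(\<lambda>n. ln (partition_sum \<phi> N n zero_seq) / real n - (c + t * real k) / real n) \<longlonglongrightarrow> top_pressure \<phi> N - 0"
      by (intro tendsto_diff lim lim_const_over_n)
    then have "\<forall>\<^sub>F n in sequentially. t < ln (partition_sum \<phi> N n zero_seq) / real n - (c + t * real k) / real n"
      by (rule order_tendstoD) (use N in simp)
    moreover have "\<forall>\<^sub>F n in sequentially. n \<ge> (1::nat)" by (rule eventually_ge_at_top)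
    ultimately have "\<forall>\<^sub>F n in sequentially. t < ln (v (n + k)) / real (n + k)"
    proof eventually_elim
      case (elim n)
      then have "t * real n < ln (partition_sum \<phi> N n zero_seq) - (c + t * real k)"
        by (simp add: diff_divide_distrib[symmetric] pos_less_divide_eq)
      then have "t * real (n + k) < ln (v (n + k))" using kc[of n] by (simp add: algebra_simps)
      then show ?case using elim by (simp add: pos_less_divide_eq)
    qed
    then show "\<forall>\<^sub>F n in sequentially. t < ln (v n) / real n"
      by (subst (asm) eventually_sequentially_seg)
  next
    fix t assume t: "pressure_val < t"
    have "(\<lambda>n. C / real n + pressure_val) \<longlonglongrightarrow> 0 + pressure_val" by (intro tendsto_add lim_const_over_n tendsto_const)
    then have "\<forall>\<^sub>F n in sequentially. C / real n + pressure_val < t" by (rule order_tendstoD) (use t in simp)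
    moreover have "\<forall>\<^sub>F n in sequentially. n \<ge> max 1 k0" by (rule eventually_ge_at_top)
    ultimately show "\<forall>\<^sub>F n in sequentially. ln (v n) / real n < t"
    proof eventually_elim
      case (elim n)
      have "ln (v n) \<le> ln (exp (C + real n * pressure_val))"
        using v_le[of n] vpos[of n] elim by (subst ln_le_cancel_iff) auto
      then have "ln (v n) / real n \<le> (C + real n * pressure_val) / real n" by (intro divide_right_mono) auto
      also have "\<dots> = C / real n + pressure_val" using elim by (simp add: field_simps)
      finally show ?case using elim by simp
    qed
  qed
  then have "(\<lambda>n. ereal (ln (v n) / real n)) \<longlonglongrightarrow> ereal pressure_val" by simp
  moreover have "\<forall>\<^sub>F n in sequentially. ereal (ln (v n) / real n) = eln (iter_one n a) / ereal (real n)"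
    using eventually_ge_at_top[of "max 1 k0"]
  proof eventually_elim
    case (elim n)
    then show ?case using vpos[of n] by (simp add: Uv eln_def)
  qed
  ultimately show ?thesis by (rule Lim_transform_eventually)
qed

end

theorem theorem5:
  fixes m :: "(nat \<Rightarrow> int) metric"
    and \<delta>\<^sub>0 C_ES lam_ES \<delta> r :: real
    and M :: "'b metric" and \<iota> :: "(nat \<Rightarrow> int) \<Rightarrow> 'b"
    and \<sigma>bar :: "'b \<Rightarrow> 'b"
    and \<phi> :: "(nat \<Rightarrow> int) \<Rightarrow> real" and \<phi>bar :: "'b \<Rightarrow> real"
  assumes shift_image: "shift ` mspace m = mspace m"
    and shift_vimage: "shift -` mspace m = mspace m"
    and bounded_compact: "\<And>N. N \<ge> 1 \<Longrightarrow>
          bounded_seqs N \<subseteq> mspace m \<and> compactin (mtopology_of m) (bounded_seqs N)"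
    and compact_bounded: "\<And>\<Lambda>. \<lbrakk>compactin (mtopology_of m) \<Lambda>; shift ` \<Lambda> \<subseteq> \<Lambda>\<rbrakk>
          \<Longrightarrow> \<exists>N\<ge>1. \<Lambda> \<subseteq> bounded_seqs N"
    and "\<delta>\<^sub>0 > 0" and "C_ES > 0" and "lam_ES > 1"
    and Exp: "\<And>c a b. \<lbrakk>a \<in> mspace m; b \<in> mspace m; mdist m a b < \<delta>\<^sub>0\<rbrakk>
          \<Longrightarrow> mdist m (c \<frown> a) (c \<frown> b) \<le> C_ES * inverse (lam_ES ^ length c) * mdist m a b"
    and Con: "\<And>R. R > 0 \<Longrightarrow> \<exists>n\<ge>1. \<forall>a\<in>mball_of m zero_seq R.
          mball_of m zero_seq R \<subseteq> (shift ^^ n) ` mball_of m a \<delta>\<^sub>0"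
    and "0 < \<delta>" and "\<delta> \<le> \<delta>\<^sub>0" and "0 < r" and "r < 1"
    and Delta: "\<And>\<psi>. weakly_Hoelder m (min \<delta> (\<delta> / C_ES)) r \<psi> \<Longrightarrow> weakly_Hoelder m \<delta> r \<psi>"
    and completion: "is_completion m M \<iota>"
    and phi: "\<phi> \<in> BV m \<delta> r"
    and i: "continuous_map (mtopology_of M) (mtopology_of M) \<sigma>bar"
           "\<And>a. a \<in> mspace m \<Longrightarrow> \<sigma>bar (\<iota> a) = \<iota> (shift a)"
    and ii: "\<And>R. R > 0 \<Longrightarrow> compactin (mtopology_of M) (mcball_of M (\<iota> zero_seq) R)"
    and iii: "\<And>R b. \<lbrakk>R > 0; b \<in> mspace M - \<iota> ` mspace m\<rbrakk> \<Longrightarrow>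
          \<exists>N\<ge>1. \<forall>n\<ge>N. (\<sigma>bar ^^ n) b \<in> mspace M - mcball_of M (\<iota> zero_seq) R"
    and iv: "(\<Sum>\<^sub>\<infinity>k::int. eexp (SUP b\<in>cyl m k. ereal (\<phi> b))) < \<infinity>"
            "((\<lambda>R. \<Sum>\<^sub>\<infinity>k::int. eexp (SUP b\<in>cyl_outside m k R. ereal (\<phi> b))) \<longlongrightarrow> 0) at_top"
    and v: "continuous_map (mtopology_of M) euclideanreal \<phi>bar"
           "\<And>a. a \<in> mspace m \<Longrightarrow> \<phi>bar (\<iota> a) = \<phi> a"
    and summable: "(SUP a\<in>mspace m. \<Sum>\<^sub>\<infinity>b\<in>{b \<in> mspace m. shift b = a}. ennreal (exp (\<phi> b))) < \<infinity>"
    and bounded_on_balls: "\<And>R. R > 0 \<Longrightarrow> bdd_above ((\<lambda>c. \<bar>\<phi> c\<bar>) ` mball_of m zero_seq R)"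
    and rapidly_decreasing:
          "((\<lambda>R. SUP a\<in>mspace M - mball_of M (\<iota> zero_seq) R.
               transfer_op (mspace M) \<sigma>bar \<phi>bar (\<lambda>_. 1) a) \<longlongrightarrow> 0) at_top"
  shows "\<exists>p::real. pressure \<phi> = ereal p \<and>
           (\<forall>a\<in>mspace M.
              (\<lambda>n. eln ((transfer_op (mspace M) \<sigma>bar \<phi>bar ^^ n) (\<lambda>_. 1) a) / ereal (real n))
                \<longlonglongrightarrow> ereal p)"
proof -
  interpret completed_shift m \<delta>\<^sub>0 C_ES lam_ES \<delta> r M \<iota> \<sigma>bar \<phi> \<phi>bar
    by (rule completed_shift.intro) fact+
  show ?thesis
    using pressure_eq iter_one_limit unfolding iter_one_def by blast
qed

end
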